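(* Consider the DSE algorithm described in the context, and let $\mathcal U$ be the random set of indices of unsuccessful iterations. Assume that $f$ is Lipschitz continuous in a neighborhood of every limit point of the sequence of iterates $\{X_k\}$. Assume the compactness condition (C), the conditional independence condition (I) and the tail condition (T) of the context. Let $c_{\max}>0$ be a constant with $\mathbb E[E_k^{\max}\mid\mathcal F_{k-1}]\le c_{\max}\Delta_k^p$ a.s. for all $k$ (such a constant exists under (T)), and assume that for some $\eta>0$ $$\eta>\frac{c_{\max}}{1-\gamma^p}\qquad\text{and}\qquad \theta\ge\eta\max\{1,\gamma^{-p}-\gamma^p\}.$$ Then, with probability one, the following implication holds: if $V\subseteq\mathcal U$ is a random index set such that $\{D_k\}_{k\in V}$ is dense in $\mathbb S^{n-1}$ and $\lim_{k\to\infty,\,k\in V}X_k=X^*$, then $X^*$ is Clarke stationary, i.e. $f^\circ(X^*;d)\ge 0$ for every $d\in\mathbb R^n$.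
   Context: **Algorithm (DSE).** Fix $p\in(1,2]$, $\theta>0$, $\gamma\in(0,1)$ and integers $\bar m\ge1$, $\bar\imath\ge0$. $f:\mathbb R^n\to\mathbb R$ is locally Lipschitz and is accessible only through random estimates $\tilde f(x)$ of $f(x)$. $\mathbb S^{n-1}$ is the unit sphere. $X_0=x_0\in\mathbb R^n$ and $\Delta_0>0$ are deterministic. At iteration $k=0,1,2,\dots$, $\mathcal G_{k-1}$ denotes the sigma-algebra of all information available before sampling the directions of iteration $k$; $X_k$ and $\Delta_k>0$ are $\mathcal G_{k-1}$-measurable. Conditionally on $\mathcal G_{k-1}$, directions $D_{k,1},\dots,D_{k,\bar m}$ are sampled independently and uniformly on $\mathbb S^{n-1}$, and $\mathcal F_{k-1}:=\mathcal G_{k-1}\vee\sigma(D_{k,1},\dots,D_{k,\bar m})$; the function estimates of iteration $k$ are drawn afterwards, and all information of iteration $k$ is contained in $\mathcal G_k\supseteq\mathcal F_{k-1}$. For $1\le m\le\bar m$, $0\le i\le\bar\imath$ put $\Delta_{k,i}:=\gamma^{-i}\Delta_k$, $X_{k,m}^{(i)}:=X_k+\Delta_{k,i}D_{k,m}$, $f_{k,m}^{(i)}:=f(X_{k,m}^{(i)})$ with random estimate $\tilde f_{k,m}^{(i)}$, and $f_k^{(-1)}:=f(X_k)$ with random estimate $\tilde f_k^{(-1)}$. The directions are tested in the order $m=1,2,\dots$; direction $m$ succeeds if $\tilde f_k^{(-1)}-\tilde f_{k,m}^{(0)}\ge\theta\Delta_k^p$. If no direction succeeds, set $H_k=-1$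 (iteration $k$ is *unsuccessful* ), $X_{k+1}=X_k$, $\Delta_{k+1}=\gamma\Delta_k$. Otherwise (iteration $k$ is *successful* ) let $m_k^*$ be the first successful index, $D_k:=D_{k,m_k^*}$, let $H_k$ be the largest $j\in\{0,\dots,\bar\imath\}$ such that $\tilde f_k^{(-1)}-\tilde f_{k,m_k^*}^{(i)}\ge\theta\Delta_{k,i}^p$ for all $i=0,\dots,j$, and set $X_{k+1}=X_k+\gamma^{-H_k}\Delta_kD_k$, with $\Delta_{k+1}=\gamma^{-1}\Delta_k$ if $H_k=0$ and $\Delta_{k+1}=\gamma^{-H_k}\Delta_k$ if $H_k\ge1$. On unsuccessful iterations $D_k:=D_{k,\bar m}$ (the last tested direction). **(C)** There is a nonempty compact set $\mathcal C\subset\mathbb R^n$ with $X_k\in\mathcal C$ a.s. for all $k\ge0$, and $\Delta_0>0$ is deterministic and finite. **(I)** For each $k$, conditionally on $\mathcal F_{k-1}$, the estimates $\tilde f_k^{(-1)}$ and $\{\tilde f_{k,m}^{(i)}:1\le m\le\bar m,\ 0\le i\le\bar\imath\}$ are mutually independent. **(T)** There is $\varepsilon_h>0$ such that for every $k$, every $\alpha\ge\varepsilon_h$, every $0\le i\le\bar\imath$ and $1\le m\le\bar m$, a.s. $$\mathbb P\big(|\tilde f_k^{(-1)}-f_k^{(-1)}|\ge\alpha\Delta_k^p\mid\mathcal F_{k-1}\big)\le\frac{\varepsilon_h}{\alpha^{p/(p-1)}},\qquad \mathbb P\big(|\tilde f_{k,m}^{(i)}-f_{k,m}^{(i)}|\ge\alpha\Delta_k^p\mid\mathcal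 F_{k-1}\big)\le\frac{\varepsilon_h}{\alpha^{p/(p-1)}}.$$ $E_k^{\max}:=\max_{1\le m\le\bar m}\max_{0\le i\le\bar\imath}\big|(\tilde f_k^{(-1)}-\tilde f_{k,m}^{(i)})-(f_k^{(-1)}-f_{k,m}^{(i)})\big|$. **Clarke derivative.** $f^\circ(x;h):=\limsup_{y\to x,\,t\downarrow0}\frac{f(y+th)-f(y)}{t}$. *)

theory Defs
  imports "HOL-Probability.Probability"
begin

definition lipschitz_near :: "('a::metric_space \<Rightarrow> real) \<Rightarrow> 'a \<Rightarrow> bool" where
  "lipschitz_near f x \<longleftrightarrow> (\<exists>r>0. \<exists>L. L-lipschitz_on (ball x r) f)"

text \<open>The base point \<open>y\<close> ranges over full neighbourhoods, so \<open>y = x\<close> is allowed.\<close>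

definition clarke_deriv :: "('a::real_normed_vector \<Rightarrow> real) \<Rightarrow> 'a \<Rightarrow> 'a \<Rightarrow> ereal" where
  "clarke_deriv f x h =
     Limsup (nhds x \<times>\<^sub>F at_right 0) (\<lambda>(y, t). ereal ((f (y + t *\<^sub>R h) - f y) / t))"

definition clarke_stationary :: "('a::real_normed_vector \<Rightarrow> real) \<Rightarrow> 'a \<Rightarrow> bool" where
  "clarke_stationary f x \<longleftrightarrow> (\<forall>d. clarke_deriv f x d \<ge> 0)"

text \<open>The normalised surface measure is the law of \<open>y / \<parallel>y\<parallel>\<close> for \<open>y\<close> uniform in the
  unit ball.\<close>

definition sphere_uniform :: "'a::euclidean_space measure" where
  "sphere_uniform = distr (uniform_measure lborel (ball 0 1)) borel sgn"

definition cprob :: "'w measure \<Rightarrow> 'w measure \<Rightarrow> 'w set \<Rightarrow> 'w \<Rightarrow> real" where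
  "cprob M F A = real_cond_exp M F (indicator A)"

definition cond_indep_vars ::
    "'w measure \<Rightarrow> 'w measure \<Rightarrow> ('i \<Rightarrow> 'b measure) \<Rightarrow> ('i \<Rightarrow> 'w \<Rightarrow> 'b) \<Rightarrow> 'i set \<Rightarrow> bool" where
  "cond_indep_vars M F N Y I \<longleftrightarrow>
     (\<forall>i\<in>I. Y i \<in> measurable M (N i)) \<and>
     (\<forall>J A. J \<subseteq> I \<and> J \<noteq> {} \<and> finite J \<and> (\<forall>j\<in>J. A j \<in> sets (N j)) \<longrightarrow>
        (AE \<omega> in M. cprob M F {\<omega> \<in> space M. \<forall>j\<in>J. Y j \<omega> \<in> A j} \<omega> =
                    (\<Prod>j\<in>J. cprob M F {\<omega> \<in> space M. Y j \<omega> \<in> A j} \<omega>)))"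

definition cond_law ::
    "'w measure \<Rightarrow> 'w measure \<Rightarrow> 'b measure \<Rightarrow> ('w \<Rightarrow> 'b) \<Rightarrow> bool" where
  "cond_law M F \<mu> Y \<longleftrightarrow> Y \<in> measurable M \<mu> \<and>
     (\<forall>A\<in>sets \<mu>. AE \<omega> in M. cprob M F {\<omega> \<in> space M. Y \<omega> \<in> A} \<omega> = measure \<mu> A)"

definition dse_step :: "real \<Rightarrow> real \<Rightarrow> nat \<Rightarrow> real" where
  "dse_step \<gamma> \<delta> i = \<delta> / \<gamma> ^ i"

definition dse_trial ::
    "real \<Rightarrow> (nat \<Rightarrow> 'w \<Rightarrow> 'a::real_vector) \<Rightarrow> (nat \<Rightarrow> 'w \<Rightarrow> real) \<Rightarrow> (nat \<Rightarrow> nat \<Rightarrow> 'w \<Rightarrow> 'a)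
      \<Rightarrow> nat \<Rightarrow> nat \<Rightarrow> nat \<Rightarrow> 'w \<Rightarrow> 'a" where
  "dse_trial \<gamma> X \<Delta> D k m i \<omega> = X k \<omega> + dse_step \<gamma> (\<Delta> k \<omega>) i *\<^sub>R D k m \<omega>"

definition dse_decrease ::
    "real \<Rightarrow> real \<Rightarrow> real \<Rightarrow> (nat \<Rightarrow> 'w \<Rightarrow> real) \<Rightarrow> (nat \<Rightarrow> 'w \<Rightarrow> real)
      \<Rightarrow> (nat \<Rightarrow> nat \<Rightarrow> nat \<Rightarrow> 'w \<Rightarrow> real) \<Rightarrow> nat \<Rightarrow> nat \<Rightarrow> nat \<Rightarrow> 'w \<Rightarrow> bool" where
  "dse_decrease p \<theta> \<gamma> \<Delta> fc fe k m i \<omega> \<longleftrightarrow>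
     fc k \<omega> - fe k m i \<omega> \<ge> \<theta> * dse_step \<gamma> (\<Delta> k \<omega>) i powr p"

definition dse_dir_algebra ::
    "'w measure \<Rightarrow> nat \<Rightarrow> (nat \<Rightarrow> 'w measure) \<Rightarrow> (nat \<Rightarrow> nat \<Rightarrow> 'w \<Rightarrow> 'a::topological_space)
      \<Rightarrow> nat \<Rightarrow> 'w measure" where
  "dse_dir_algebra M mbar G D k =
     sigma (space M)
       (sets (G k) \<union> {D k m -` B \<inter> space M | m B. m \<in> {1..mbar} \<and> B \<in> sets borel})"

definition dse_Emax ::
    "real \<Rightarrow> nat \<Rightarrow> nat \<Rightarrow> ('a::real_vector \<Rightarrow> real) \<Rightarrow> (nat \<Rightarrow> 'w \<Rightarrow> 'a) \<Rightarrow> (nat \<Rightarrow> 'w \<Rightarrow> real)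
      \<Rightarrow> (nat \<Rightarrow> nat \<Rightarrow> 'w \<Rightarrow> 'a) \<Rightarrow> (nat \<Rightarrow> 'w \<Rightarrow> real) \<Rightarrow> (nat \<Rightarrow> nat \<Rightarrow> nat \<Rightarrow> 'w \<Rightarrow> real)
      \<Rightarrow> nat \<Rightarrow> 'w \<Rightarrow> real" where
  "dse_Emax \<gamma> mbar ibar f X \<Delta> D fc fe k \<omega> =
     (MAX m\<in>{1..mbar}. MAX i\<in>{0..ibar}.
        \<bar>(fc k \<omega> - fe k m i \<omega>) - (f (X k \<omega>) - f (dse_trial \<gamma> X \<Delta> D k m i \<omega>))\<bar>)"

text \<open>Sigma-algebras are indexed from 0: \<open>G k\<close> carries the information available before the
  directions of iteration \<open>k\<close> are sampled (\<open>\<G>\<^sub>k\<^sub>-\<^sub>1\<close> on paper), and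
  \<open>dse_dir_algebra M mbar G D k\<close> is \<open>\<F>\<^sub>k\<^sub>-\<^sub>1\<close>.  The processes \<open>fc k\<close> and \<open>fe k m i\<close> are the
  estimates of \<open>f\<close> at \<open>X k\<close> and at \<open>dse_trial \<gamma> X \<Delta> D k m i\<close>;
  \<open>D k m\<close> is the \<open>m\<close>-th sampled direction and \<open>Dsel k\<close> the direction \<open>D\<^sub>k\<close> singled out at
  iteration \<open>k\<close>.\<close>

locale dse = prob_space M for M :: "'w measure" +
  fixes p \<theta> \<gamma> :: real
    and mbar ibar :: nat
    and f :: "'a::euclidean_space \<Rightarrow> real"
    and x0 :: 'a
    and \<delta>0 :: real
    and G :: "nat \<Rightarrow> 'w measure"
    and X :: "nat \<Rightarrow> 'w \<Rightarrow> 'a"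
    and \<Delta> :: "nat \<Rightarrow> 'w \<Rightarrow> real"
    and D :: "nat \<Rightarrow> nat \<Rightarrow> 'w \<Rightarrow> 'a"
    and fc :: "nat \<Rightarrow> 'w \<Rightarrow> real"
    and fe :: "nat \<Rightarrow> nat \<Rightarrow> nat \<Rightarrow> 'w \<Rightarrow> real"
    and H :: "nat \<Rightarrow> 'w \<Rightarrow> int"
    and Dsel :: "nat \<Rightarrow> 'w \<Rightarrow> 'a"
  assumes p: "1 < p" "p \<le> 2"
    and theta: "\<theta> > 0"
    and gamma: "0 < \<gamma>" "\<gamma> < 1"
    and mbar: "mbar \<ge> 1"
    and locally_lipschitz: "\<And>x. lipschitz_near f x"
    and subalgebra_G: "\<And>k. subalgebra M (G k)"
    and subalgebra_Suc: "\<And>k. subalgebra (G (Suc k)) (dse_dir_algebra M mbar G D k)"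
    and X_measurable: "\<And>k. X k \<in> borel_measurable (G k)"
    and Delta_measurable: "\<And>k. \<Delta> k \<in> borel_measurable (G k)"
    and fc_measurable: "\<And>k. fc k \<in> borel_measurable (G (Suc k))"
    and fe_measurable: "\<And>k m i. m \<in> {1..mbar} \<Longrightarrow> i \<le> ibar \<Longrightarrow>
           fe k m i \<in> borel_measurable (G (Suc k))"
    and D_indep: "\<And>k. cond_indep_vars M (G k) (\<lambda>_. borel) (D k) {1..mbar}"
    and D_uniform: "\<And>k m. m \<in> {1..mbar} \<Longrightarrow> cond_law M (G k) sphere_uniform (D k m)"
    and delta0: "\<delta>0 > 0"
    and init: "\<And>\<omega>. \<omega> \<in> space M \<Longrightarrow> X 0 \<omega> = x0" "\<And>\<omega>. \<omega> \<in> space M \<Longrightarrow> \<Delta> 0 \<omega> = \<delta>0"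
    and Delta_pos: "\<And>k \<omega>. \<omega> \<in> space M \<Longrightarrow> \<Delta> k \<omega> > 0"
    and unsuccessful:
      "\<And>k \<omega>. \<omega> \<in> space M \<Longrightarrow> \<forall>m\<in>{1..mbar}. \<not> dse_decrease p \<theta> \<gamma> \<Delta> fc fe k m 0 \<omega> \<Longrightarrow>
         H k \<omega> = -1 \<and> Dsel k \<omega> = D k mbar \<omega> \<and>
         X (Suc k) \<omega> = X k \<omega> \<and> \<Delta> (Suc k) \<omega> = \<gamma> * \<Delta> k \<omega>"
    and successful:
      "\<And>k m \<omega>. \<omega> \<in> space M \<Longrightarrow> m \<in> {1..mbar} \<Longrightarrow> dse_decrease p \<theta> \<gamma> \<Delta> fc fe k m 0 \<omega> \<Longrightarrow>
         \<forall>m'\<in>{1..<m}. \<not> dse_decrease p \<theta> \<gamma> \<Delta> fc fe k m' 0 \<omega> \<Longrightarrow>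
         H k \<omega> = int (Max {j \<in> {0..ibar}. \<forall>i\<in>{0..j}. dse_decrease p \<theta> \<gamma> \<Delta> fc fe k m i \<omega>}) \<and>
         Dsel k \<omega> = D k m \<omega> \<and>
         X (Suc k) \<omega> = X k \<omega> + dse_step \<gamma> (\<Delta> k \<omega>) (nat (H k \<omega>)) *\<^sub>R Dsel k \<omega> \<and>
         \<Delta> (Suc k) \<omega> =
           (if H k \<omega> = 0 then \<Delta> k \<omega> / \<gamma> else dse_step \<gamma> (\<Delta> k \<omega>) (nat (H k \<omega>)))"

end

theory Submission
  imports Defs
begin

text \<open>Along every path the Lyapunov function \<open>f (X k) + \<eta> * \<Delta> k powr p\<close> drops by at least
  \<open>\<eta> * (1 - \<gamma> powr p) * \<Delta> k powr p\<close>, up to the error \<open>Emax k\<close>, whose mean is at most \<open>c_max\<close> times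
  that of \<open>\<Delta> k powr p\<close>. Taking expectations, the means of \<open>\<Delta> k powr p\<close> are summable. Hence almost
  surely \<open>\<Delta> k\<close> tends to 0, and by the tail bound and Borel--Cantelli the estimation errors are
  \<open>o(\<Delta> k)\<close>. If the limit point is not Clarke stationary, then near it \<open>f\<close> decreases at a fixed
  rate in some unit direction \<open>u\<close>. In dimension at least two the sphere has no isolated points, so
  arbitrarily late unsuccessful iterations use directions close to \<open>u\<close>, and these should have
  succeeded. In dimension one the whole sequence is trapped near the limit point, and the step sizes
  dominate the exponential of a fair random walk, which almost surely does not tend to \<open>- \<infinity>\<close>.\<close>

subsection \<open>Clarke stationarity and directions\<close>

text \<open>A negative limsup keeps the difference quotients below a negative constant uniformly
  over base points in a ball and over small steps, so one rate serves at all nearby iterates. The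
  derivative in direction zero is 0, hence the bad direction can be normalised.\<close>

lemma not_clarke_stationaryD:
  fixes f :: "'a::real_normed_vector \<Rightarrow> real"
  assumes "\<not> clarke_stationary f x"
  obtains u c r where "norm u = 1" "c > 0" "r > 0"
    "\<And>y t. y \<in> ball x r \<Longrightarrow> 0 < t \<Longrightarrow> t < r \<Longrightarrow> f (y + t *\<^sub>R u) - f y \<le> - c * t"
proof -
  obtain d where d: "clarke_deriv f x d < 0"
    using assms by (auto simp: clarke_stationary_def not_le)
  have "d \<noteq> 0"
  proof
    assume "d = 0"
    then have "clarke_deriv f x d = Limsup (nhds x \<times>\<^sub>F at_right (0::real)) (\<lambda>_. 0::ereal)"
      by (simp add: clarke_deriv_def case_prod_unfold zero_ereal_def)
    also have "\<dots> = 0"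
      by (rule Limsup_const) (simp add: prod_filter_eq_bot)
    finally show False using d by simp
  qed
  obtain e where e: "clarke_deriv f x d < ereal (- e)" "e > 0"
  proof -
    obtain b where "clarke_deriv f x d < ereal b" "ereal b < 0"
      using ereal_dense2[OF d] by auto
    then show thesis using that[of "- b"] by simp
  qed
  have "eventually (\<lambda>(y, t). (f (y + t *\<^sub>R d) - f y) / t < - e) (nhds x \<times>\<^sub>F at_right 0)"
    using Limsup_lessD[OF e(1)[unfolded clarke_deriv_def]] by (simp add: case_prod_unfold)
  then obtain P Q where P: "eventually P (nhds x)" and Q: "eventually Q (at_right (0::real))"
    and PQ: "\<And>y t. P y \<Longrightarrow> Q t \<Longrightarrow> (f (y + t *\<^sub>R d) - f y) / t < - e"
    unfolding eventually_prod_filter by auto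
  from P obtain r1 where r1: "r1 > 0" "\<And>y. dist y x < r1 \<Longrightarrow> P y"
    unfolding eventually_nhds_metric by blast
  from Q obtain r2 where r2: "r2 > 0" "\<And>t. 0 < t \<Longrightarrow> t < r2 \<Longrightarrow> Q t"
    unfolding eventually_at_right_field by blast
  have nd: "norm d > 0" using \<open>d \<noteq> 0\<close> by simp
  show thesis
  \<comment> \<open>A step \<open>t\<close> along \<open>sgn d\<close> is a step
    \<open>t / norm d\<close> along \<open>d\<close>, which explains the rate
    \<open>e / norm d\<close> and the radius \<open>r2 * norm d\<close>.\<close>
  proof (rule that[of "sgn d" "e / norm d" "min r1 (r2 * norm d)"])
    show "norm (sgn d) = 1" using \<open>d \<noteq> 0\<close> by (simp add: norm_sgn)
    fix y and t :: real
    assume y: "y \<in> ball x (min r1 (r2 * norm d))" and t: "0 < t" "t < min r1 (r2 * norm d)"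
    have "Q (t / norm d)" using t nd by (intro r2) (auto simp: field_simps)
    moreover have "P y" using y by (intro r1) (simp add: dist_commute)
    ultimately have "(f (y + (t / norm d) *\<^sub>R d) - f y) / (t / norm d) < - e" by (intro PQ)
    then have "f (y + (t / norm d) *\<^sub>R d) - f y < - e * (t / norm d)"
      using t nd by (subst (asm) pos_divide_less_eq) auto
    then show "f (y + t *\<^sub>R sgn d) - f y \<le> - (e / norm d) * t"
      by (simp add: sgn_div_norm divide_inverse mult_ac)
  qed (use e r1 r2 nd in auto)
qed

lemma lipschitz_near_imp_continuous:
  assumes "\<And>x. lipschitz_near f x"
  shows "continuous_on UNIV f"
proof (rule continuous_at_imp_continuous_on, rule ballI)
  fix x
  obtain r L where "r > 0" "L-lipschitz_on (ball x r) f"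
    using assms unfolding lipschitz_near_def by blast
  then show "isCont f x"
    using lipschitz_on_continuous_on[of L "ball x r" f] continuous_on_interior[of "ball x r" f x]
    by simp
qed

text \<open>Discarding the indices below \<open>K\<close> loses only finitely many points, and a
  finite set is closed without limit points. So a limit point of \<open>S\<close> is still
  approximated using late indices alone.\<close>

lemma closure_image_tail:
  fixes g :: "nat \<Rightarrow> 'a::t1_space"
  assumes "S \<subseteq> closure (g ` V)" and "x islimpt S"
  shows "x \<in> closure (g ` (V \<inter> {K..}))"
proof -
  have "g ` V \<subseteq> g ` (V \<inter> {K..}) \<union> g ` {..<K}" by fastforce
  then have "closure (g ` V) \<subseteq> closure (g ` (V \<inter> {K..})) \<union> closure (g ` {..<K})"
    unfolding closure_Un[symmetric] by (rule closure_mono)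
  also have "closure (g ` {..<K}) = g ` {..<K}"
    by (intro closure_closed finite_imp_closed) simp
  finally have "x islimpt closure (g ` (V \<inter> {K..})) \<union> g ` {..<K}"
    using assms by (meson islimpt_subset subset_trans)
  then have "x islimpt closure (g ` (V \<inter> {K..}))"
    by (simp add: islimpt_Un islimpt_finite)
  then show ?thesis
    using closed_closure closed_limpt by blast
qed

text \<open>In dimension at least two the sphere is connected, and it contains the two distinct
  points \<open>u\<close> and \<open>- u\<close>; a connected set with more than one point has no
  isolated point.\<close>

lemma sphere_islimpt:
  fixes u :: "'a::euclidean_space"
  assumes "DIM('a) \<ge> 2" "norm u = 1"
  shows "u islimpt sphere 0 1"
proof (rule connected_imp_perfect)
  show "connected (sphere (0::'a) 1)" using assms(1) by (intro connected_sphere)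
  have "- u \<in> sphere 0 1" "u \<in> sphere 0 1" "u \<noteq> - u"
    using assms(2) by (auto simp: eq_neg_iff_add_eq_0 scaleR_2[symmetric])
  then show "sphere 0 1 \<noteq> {x}" for x :: 'a by (metis singletonD)
  show "u \<in> sphere 0 1" using assms(2) by simp
qed

lemma DIM_1_eq_scaleR:
  fixes b x :: "'a::euclidean_space"
  assumes "DIM('a) = 1" "norm b = 1"
  shows "x = (x \<bullet> b) *\<^sub>R b"
proof -
  obtain e :: 'a where e: "Basis = {e}" using assms(1) card_1_singletonE by metis
  have rep: "y = (y \<bullet> e) *\<^sub>R e" for y by (subst euclidean_representation[of y, symmetric]) (simp add: e)
  have ee: "e \<bullet> e = 1" by (rule inner_same_Basis) (simp add: e)
  obtain s t where s: "b = s *\<^sub>R e" and t: "x = t *\<^sub>R e" using rep by metis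
  have "b \<bullet> b = 1" using assms(2) by (simp add: dot_square_norm)
  then have "s * s = 1" by (simp add: s ee)
  then show ?thesis by (simp add: s t ee mult.assoc)
qed

subsection \<open>Conditional laws and tail bounds\<close>

text \<open>Exchanging sum and integral of nonnegative terms shows that the sum has finite
  expectation, so it is finite almost everywhere.\<close>

lemma (in prob_space) AE_summable_of_expectation:
  fixes g :: "nat \<Rightarrow> 'a \<Rightarrow> real"
  assumes int: "\<And>k. integrable M (g k)" and nonneg: "\<And>k x. x \<in> space M \<Longrightarrow> g k x \<ge> 0"
    and sum: "summable (\<lambda>k. expectation (g k))"
  shows "AE x in M. summable (\<lambda>k. g k x)"
proof -
  have [measurable]: "g k \<in> borel_measurable M" for k using int by auto
  have "(\<integral>\<^sup>+x. (\<Sum>k. ennreal (g k x)) \<partial>M) = (\<Sum>k. \<integral>\<^sup>+x. ennreal (g k x) \<partial>M)"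
    by (rule nn_integral_suminf) measurable
  also have "\<dots> = (\<Sum>k. ennreal (expectation (g k)))"
    using int nonneg by (intro suminf_cong nn_integral_eq_integral) auto
  also have "\<dots> \<noteq> \<infinity>"
    using sum nonneg by (subst suminf_ennreal2) (auto intro!: integral_nonneg_AE)
  finally have "AE x in M. (\<Sum>k. ennreal (g k x)) \<noteq> \<infinity>"
    by (intro nn_integral_PInf_AE) measurable
  then show ?thesis
  proof (rule AE_mp, intro AE_I2 impI)
    fix x assume "x \<in> space M" "(\<Sum>k. ennreal (g k x)) \<noteq> \<infinity>"
    then show "summable (\<lambda>k. g k x)"
      using nonneg by (intro summable_suminf_not_top) auto
  qed
qed

text \<open>The conditional probability of the event \<open>Y \<in> B\<close> is a constant, so
  integrating it over an event of \<open>F\<close> gives a product: \<open>Y\<close> is independent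
  of \<open>F\<close>.\<close>

lemma (in prob_space) prob_Int_cond_law:
  assumes F: "subalgebra M F" and law: "cond_law M F \<mu> Y" and A: "A \<in> sets F" and B: "B \<in> sets \<mu>"
  shows "prob (A \<inter> {\<omega> \<in> space M. Y \<omega> \<in> B}) = prob A * measure \<mu> B"
proof -
  interpret sigma_finite_subalgebra M F
    using F by (intro finite_measure_subalgebra_is_sigma_finite finite_measure_subalgebra.intro
      finite_measure_subalgebra_axioms.intro finite_measure_axioms)
  let ?E = "{\<omega> \<in> space M. Y \<omega> \<in> B}"
  have Y: "Y \<in> measurable M \<mu>" using law by (simp add: cond_law_def)
  have E: "?E \<in> sets M" using measurable_sets[OF Y B] by (simp add: vimage_def Int_def conj_commute)
  have AM: "A \<in> sets M" using A F by (auto simp: subalgebra_def)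
  have "prob (A \<inter> ?E) = (\<integral>\<omega>\<in>A. indicator ?E \<omega> \<partial>M)"
    using AM E by (simp add: set_lebesgue_integral_def indicator_inter_arith[symmetric] Int_absorb1
      sets.sets_into_space)
  also have "\<dots> = (\<integral>\<omega>\<in>A. real_cond_exp M F (indicator ?E) \<omega> \<partial>M)"
    using A E by (intro real_cond_exp_intA) (auto intro!: integrable_real_indicator simp: emeasure_eq_measure)
  also have "\<dots> = (\<integral>\<omega>\<in>A. measure \<mu> B \<partial>M)"
  proof (rule set_lebesgue_integral_cong_AE)
    show "AE \<omega>\<in>A in M. real_cond_exp M F (indicator ?E) \<omega> = measure \<mu> B"
      using law B unfolding cond_law_def cprob_def by auto
  qed (use AM in auto)
  also have "\<dots> = prob A * measure \<mu> B"
    using AM by (simp add: set_integral_const emeasure_eq_measure)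
  finally show ?thesis .
qed

text \<open>The tail bound holds for deterministic \<alpha>, off a null set depending on \<alpha>,
  whereas the threshold \<open>e * \<Delta>\<close> amounts to the random level
  \<open>e * \<Delta> powr (1 - p)\<close>. As \<Delta> has countably many values, the event is cut
  along the level sets of \<Delta>, where that level is constant. The exponent
  \<open>p / (p - 1)\<close> turns it into exactly the factor
  \<open>\<Delta> powr p\<close>.\<close>

lemma (in prob_space) emeasure_tail_le:
  fixes \<Delta> Y :: "'a \<Rightarrow> real"
  assumes F: "subalgebra M F" and Y[measurable]: "Y \<in> borel_measurable M"
    and \<Delta>F: "\<Delta> \<in> borel_measurable F"
    and pos: "\<And>\<omega>. \<omega> \<in> space M \<Longrightarrow> \<Delta> \<omega> > 0"
    and R: "countable R" "\<And>\<omega>. \<omega> \<in> space M \<Longrightarrow> \<Delta> \<omega> \<in> R"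
    and p: "p > 1" and \<epsilon>: "\<epsilon> > 0" and e: "e > 0"
    and tail: "\<And>\<alpha>. \<alpha> \<ge> \<epsilon> \<Longrightarrow> AE \<omega> in M. cprob M F {\<omega> \<in> space M. Y \<omega> \<ge> \<alpha> * \<Delta> \<omega> powr p} \<omega>
              \<le> \<epsilon> / \<alpha> powr (p / (p - 1))"
  shows "emeasure M {\<omega> \<in> space M. Y \<omega> \<ge> e * \<Delta> \<omega>}
     \<le> (\<integral>\<^sup>+\<omega>. ennreal ((\<epsilon> + \<epsilon> powr (p / (p - 1))) / e powr (p / (p - 1)) * \<Delta> \<omega> powr p) \<partial>M)"
proof -
  interpret sigma_finite_subalgebra M F
    using F by (intro finite_measure_subalgebra_is_sigma_finite finite_measure_subalgebra.intro
      finite_measure_subalgebra_axioms.intro finite_measure_axioms)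
  have [measurable]: "\<Delta> \<in> borel_measurable M" using measurable_from_subalg[OF F \<Delta>F] .
  define q where "q = p / (p - 1)"
  define C where "C = (\<epsilon> + \<epsilon> powr q) / e powr q"
  have C: "C \<ge> 0" using \<epsilon> by (auto simp: C_def)
  define S where "S v = {\<omega> \<in> space M. \<Delta> \<omega> = v}" for v
  have SF: "S v \<in> sets F" for v
  proof -
    have "\<Delta> -` {v} \<inter> space F \<in> sets F" using measurable_sets[OF \<Delta>F, of "{v}"] by simp
    moreover have "\<Delta> -` {v} \<inter> space F = S v" using F by (auto simp: S_def subalgebra_def)
    ultimately show ?thesis by simp
  qed
  have SM[measurable]: "S v \<in> sets M" for v using SF F by (auto simp: subalgebra_def)
  let ?E = "{\<omega> \<in> space M. Y \<omega> \<ge> e * \<Delta> \<omega>}"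
  have E: "?E \<in> sets M" by measurable
  have level: "emeasure M (?E \<inter> S v) \<le> ennreal (C * v powr p) * emeasure M (S v)" if v: "v > 0" for v
  proof -
    \<comment> \<open>Chosen so that \<open>\<alpha> * v powr p = e * v\<close>: on
      \<open>S v\<close> the tail event at level \<alpha> is the event to be bounded.\<close>
    define \<alpha> where "\<alpha> = e * v powr (1 - p)"
    have \<alpha>: "\<alpha> > 0" using e v by (simp add: \<alpha>_def)
    have \<alpha>q: "\<alpha> powr q = e powr q / v powr p"
    proof -
      have "(1 - p) * q = - p" using p by (simp add: q_def field_simps)
      then show ?thesis using e v
        by (simp add: \<alpha>_def powr_mult powr_powr powr_minus divide_inverse)
    qed
    have Cv: "C * v powr p = (\<epsilon> + \<epsilon> powr q) / \<alpha> powr q"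
      using e v by (simp add: C_def \<alpha>q)
    show ?thesis
    proof (cases "\<alpha> \<ge> \<epsilon>")
      case True
      let ?A = "{\<omega> \<in> space M. Y \<omega> \<ge> \<alpha> * \<Delta> \<omega> powr p}"
      have "\<alpha> * v powr p = e * v" using v by (simp add: \<alpha>_def powr_add[symmetric])
      then have eq: "?E \<inter> S v = S v \<inter> ?A" by (auto simp: S_def)
      have A: "?A \<in> sets M" by measurable
      have iA: "integrable M (indicator ?A :: 'a \<Rightarrow> real)"
        using A by (auto intro!: integrable_real_indicator simp: emeasure_eq_measure)
      have "prob (S v \<inter> ?A) = (\<integral>\<omega>\<in>S v. indicator ?A \<omega> \<partial>M)"
        using A SM[of v] by (simp add: set_lebesgue_integral_def indicator_inter_arith[symmetric]
          Int_absorb1 sets.sets_into_space)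
      also have "\<dots> = (\<integral>\<omega>\<in>S v. real_cond_exp M F (indicator ?A) \<omega> \<partial>M)"
        using SF A iA by (intro real_cond_exp_intA) auto
      also have "\<dots> \<le> (\<integral>\<omega>\<in>S v. \<epsilon> / \<alpha> powr q \<partial>M)"
        unfolding set_lebesgue_integral_def
      proof (rule integral_mono_AE)
        show "integrable M (\<lambda>\<omega>. indicat_real (S v) \<omega> *\<^sub>R real_cond_exp M F (indicator ?A) \<omega>)"
          using real_cond_exp_int(1)[OF iA] by (intro integrable_mult_indicator) auto
        show "AE \<omega> in M. indicat_real (S v) \<omega> *\<^sub>R real_cond_exp M F (indicator ?A) \<omega>
            \<le> indicat_real (S v) \<omega> *\<^sub>R (\<epsilon> / \<alpha> powr q)"
          using tail[OF True] unfolding cprob_def q_def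
          by eventually_elim (auto split: split_indicator)
      qed (simp add: emeasure_eq_measure)
      also have "\<dots> = prob (S v) * (\<epsilon> / \<alpha> powr q)"
        by (simp add: set_integral_const emeasure_eq_measure)
      also have "\<dots> \<le> prob (S v) * (C * v powr p)"
        unfolding Cv by (intro mult_left_mono divide_right_mono) auto
      finally show ?thesis
        unfolding eq emeasure_eq_measure using C
        by (simp add: ennreal_mult'[symmetric] mult.commute)
    next
      \<comment> \<open>Below \<epsilon> the tail condition says nothing, but there the claimed
        factor is at least 1. The summand \<open>\<epsilon> powr q\<close> in \<open>C\<close> was
        included for this.\<close>
      case False
      have "q > 0" using p by (simp add: q_def)
      then have "\<alpha> powr q \<le> \<epsilon> powr q" using False \<alpha> by (intro powr_mono2) auto
      then have "1 \<le> C * v powr p" using \<alpha> \<epsilon> by (simp add: Cv field_simps)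
      then have "emeasure M (S v) \<le> ennreal (C * v powr p) * emeasure M (S v)"
        using mult_right_mono[of 1 "ennreal (C * v powr p)" "emeasure M (S v)"] by simp
      then show ?thesis using emeasure_mono[of "?E \<inter> S v" "S v" M] by (auto intro: order_trans)
    qed
  qed
  define R' where "R' = R \<inter> {0<..}"
  have R': "countable R'" using R by (simp add: R'_def)
  have cover: "?E = (\<Union>v\<in>R'. ?E \<inter> S v)" using R pos by (auto simp: S_def R'_def)
  have "emeasure M ?E = emeasure M (\<Union>v\<in>R'. ?E \<inter> S v)" using cover by simp
  also have "\<dots> = (\<integral>\<^sup>+v. emeasure M (?E \<inter> S v) \<partial>count_space R')"
    using E R' by (intro emeasure_UN_countable) (auto simp: disjoint_family_on_def S_def)
  also have "\<dots> \<le> (\<integral>\<^sup>+v. ennreal (C * v powr p) * emeasure M (S v) \<partial>count_space R')"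
    by (intro nn_integral_mono level) (auto simp: R'_def)
  also have "\<dots> = (\<integral>\<^sup>+v. (\<integral>\<^sup>+\<omega>. ennreal (C * \<Delta> \<omega> powr p) * indicator (S v) \<omega> \<partial>M) \<partial>count_space R')"
  proof (intro nn_integral_cong)
    fix v
    have "(\<integral>\<^sup>+\<omega>. ennreal (C * \<Delta> \<omega> powr p) * indicator (S v) \<omega> \<partial>M)
        = (\<integral>\<^sup>+\<omega>. ennreal (C * v powr p) * indicator (S v) \<omega> \<partial>M)"
      by (intro nn_integral_cong) (auto simp: S_def split: split_indicator)
    then show "ennreal (C * v powr p) * emeasure M (S v)
        = (\<integral>\<^sup>+\<omega>. ennreal (C * \<Delta> \<omega> powr p) * indicator (S v) \<omega> \<partial>M)"
      by (simp add: nn_integral_cmult_indicator)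
  qed
  \<comment> \<open>Read as masses of a density, the contributions of the disjoint level sets add up
    to the integral over the whole space.\<close>
  also have "\<dots> = (\<integral>\<^sup>+v. emeasure (density M (\<lambda>\<omega>. ennreal (C * \<Delta> \<omega> powr p))) (S v) \<partial>count_space R')"
    by (intro nn_integral_cong) (subst emeasure_density, auto)
  also have "\<dots> = emeasure (density M (\<lambda>\<omega>. ennreal (C * \<Delta> \<omega> powr p))) (\<Union>v\<in>R'. S v)"
    using R' by (intro emeasure_UN_countable[symmetric]) (auto simp: disjoint_family_on_def S_def)
  also have "(\<Union>v\<in>R'. S v) = space M" using R pos by (auto simp: S_def R'_def)
  also have "emeasure (density M (\<lambda>\<omega>. ennreal (C * \<Delta> \<omega> powr p))) (space M)
      = (\<integral>\<^sup>+\<omega>. ennreal (C * \<Delta> \<omega> powr p) \<partial>M)"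
    by (subst emeasure_density) (auto intro!: nn_integral_cong)
  finally show ?thesis by (simp add: C_def q_def)
qed

subsection \<open>Uniform directions\<close>

text \<open>The reflection \<open>y \<mapsto> - y\<close> preserves Lebesgue measure and exchanges
  the two halves of the ball; in dimension one these cover everything but the origin.\<close>

lemma measure_sphere_uniform_half:
  fixes b :: "'a::euclidean_space"
  assumes "DIM('a) = 1" "norm b = 1"
  shows "measure sphere_uniform {x::'a. 0 < x \<bullet> b} = 1 / 2"
proof -
  let ?B = "ball (0::'a) 1"
  let ?P = "?B \<inter> {y. 0 < y \<bullet> b}" and ?N = "?B \<inter> {y. y \<bullet> b < 0}"
  have B: "emeasure lborel ?B \<noteq> 0" "emeasure lborel ?B \<noteq> \<infinity>"
    using emeasure_lborel_ball_finite[of "0::'a" 1] content_ball_pos[of 1 "0::'a"]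
    by (auto simp: emeasure_eq_ennreal_measure)
  have fin: "?P \<in> fmeasurable lborel" "?N \<in> fmeasurable lborel"
    using emeasure_lborel_ball_finite[of "0::'a" 1]
    by (auto intro!: fmeasurableI2[OF fmeasurableI, of ?B])
  have "emeasure lborel ?N = emeasure (distr lborel borel (\<lambda>x::'a. - x)) ?N"
    using lborel_affine[of "-1" "0::'a"] by (simp add: density_1)
  also have "\<dots> = emeasure lborel ?P"
    by (subst emeasure_distr) (auto intro!: arg_cong2[where f = emeasure])
  finally have NP: "measure lborel ?N = measure lborel ?P" by (simp add: measure_def)
  have "?B = {0} \<union> (?P \<union> ?N)"
    using DIM_1_eq_scaleR[OF assms] by (auto simp: linorder_neq_iff) (metis not_less_iff_gr_or_eq scaleR_zero_left)
  then have "measure lborel ?B = measure lborel ({0} \<union> (?P \<union> ?N))" by simp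
  also have "\<dots> = measure lborel {0::'a} + measure lborel (?P \<union> ?N)"
    using fin fmeasurable.Un[OF fin] by (intro measure_Union) (auto simp: fmeasurable_def)
  also have "measure lborel (?P \<union> ?N) = measure lborel ?P + measure lborel ?N"
    using fin by (intro measure_Union) (auto simp: fmeasurable_def)
  finally have PB: "measure lborel ?B = 2 * measure lborel ?P" using NP by (simp add: measure_def)
  have "measure sphere_uniform {x::'a. 0 < x \<bullet> b}
      = measure (uniform_measure lborel ?B) {y. 0 < sgn y \<bullet> b}"
    unfolding sphere_uniform_def by (subst measure_distr) (auto simp: vimage_def)
  also have "{y. 0 < sgn y \<bullet> b} = {y. 0 < y \<bullet> b}"
    by (auto simp: sgn_div_norm zero_less_mult_iff)
  also have "measure (uniform_measure lborel ?B) {y. 0 < y \<bullet> b} = measure lborel ?P / measure lborel ?B"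
    using B by (intro measure_uniform_measure) auto
  finally show ?thesis using PB content_ball_pos[of 1 "0::'a"] by simp
qed

text \<open>\<open>sgn\<close> sends every point except the origin to the sphere, and the origin is
  a null set.\<close>

lemma measure_sphere_uniform_sphere:
  "measure sphere_uniform (sphere (0::'a::euclidean_space) 1) = 1"
proof -
  let ?B = "ball (0::'a) 1"
  have B: "emeasure lborel ?B \<noteq> 0" "emeasure lborel ?B \<noteq> \<infinity>"
    using emeasure_lborel_ball_finite[of "0::'a" 1] content_ball_pos[of 1 "0::'a"]
    by (auto simp: emeasure_eq_ennreal_measure)
  have "measure sphere_uniform (sphere (0::'a) 1)
      = measure (uniform_measure lborel ?B) {y. norm (sgn y) = 1}"
    unfolding sphere_uniform_def by (subst measure_distr) (auto simp: vimage_def)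
  also have "{y::'a. norm (sgn y) = 1} = - {0}"
    by (auto simp: norm_sgn)
  also have "measure (uniform_measure lborel ?B) (- {0}) = measure lborel (?B \<inter> - {0}) / measure lborel ?B"
    using B by (intro measure_uniform_measure) auto
  also have "measure lborel (?B \<inter> - {0}) = measure lborel ?B"
  proof -
    have "measure lborel (?B - {0}) = measure lborel ?B"
      by (intro measure_Diff_null_set) auto
    then show ?thesis by (simp add: Diff_eq)
  qed
  finally show ?thesis using content_ball_pos[of 1 "0::'a"] by simp
qed

lemma sets_sphere_uniform [measurable_cong]: "sets sphere_uniform = sets borel"
  by (simp add: sphere_uniform_def)

subsection \<open>Fair random walks\<close>

text \<open>The gambler's ruin walk, frozen once it leaves the open interval from \<open>- L\<close>
  to \<open>1\<close>.\<close>

primrec stopped_walk :: "real \<Rightarrow> (nat \<Rightarrow> real) \<Rightarrow> nat \<Rightarrow> real" where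
  "stopped_walk L x 0 = 0"
| "stopped_walk L x (Suc n) = stopped_walk L x n +
     (if - L < stopped_walk L x n \<and> stopped_walk L x n < 1 then x n else 0)"

text \<open>Unit steps between integers cannot jump over an integer barrier, so the walk leaves the
  interval exactly at an endpoint.\<close>

lemma stopped_walk_bounds:
  assumes x: "\<And>n. x n \<in> {-1, 1}" and L: "L \<in> \<int>" "L \<ge> 1"
  shows "stopped_walk L x n \<in> \<int> \<and> - L \<le> stopped_walk L x n \<and> stopped_walk L x n \<le> 1"
proof (induction n)
  case (Suc n)
  obtain s :: int where s: "stopped_walk L x n = of_int s"
    using Suc by (auto elim: Ints_cases)
  obtain l :: int where l: "L = of_int l" using L by (auto elim: Ints_cases)
  have "- real_of_int l \<le> real_of_int s - 1" if "- real_of_int l < real_of_int s"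
  proof -
    have "real_of_int (- l) < real_of_int s" using that by simp
    then have "real_of_int (- l) \<le> real_of_int (s - 1)" by (simp only: of_int_less_iff of_int_le_iff)
    then show ?thesis by simp
  qed
  then show ?case using Suc x[of n] L unfolding stopped_walk.simps s unfolding l
    by (auto split: if_splits)
qed (use L in auto)

lemma stopped_walk_stays:
  assumes "stopped_walk L x n \<le> - L"
  shows "stopped_walk L x (Suc n) \<le> - L"
  using assms by auto

text \<open>Restarted at a time \<open>K\<close> where it attains its maximum, a path diverging to \<open>- \<infinity>\<close> never
  exceeds its starting point, so stopping at \<open>1\<close> is never triggered.\<close>

lemma walk_at_bot_reaches:
  fixes x :: "nat \<Rightarrow> real"
  assumes lim: "filterlim (\<lambda>n. \<Sum>j<n. x j) at_bot sequentially"
  shows "\<exists>K. \<forall>L. \<exists>n. stopped_walk L (\<lambda>j. x (K + j)) n \<le> - L"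
proof -
  define S where "S n = (\<Sum>j<n. x j)" for n
  have limS: "filterlim S at_bot sequentially" using lim by (simp add: S_def[abs_def])
  then have "eventually (\<lambda>n. S n \<le> S 0) sequentially" unfolding filterlim_at_bot by blast
  then obtain N where N: "\<And>n. n \<ge> N \<Longrightarrow> S n \<le> S 0" unfolding eventually_sequentially by blast
  \<comment> \<open>Past \<open>N\<close> the path is at most \<open>S 0\<close>, so a maximiser
    among the indices up to \<open>N\<close> is a global one.\<close>
  obtain K where K: "K \<le> N" "\<And>n. n \<le> N \<Longrightarrow> S n \<le> S K"
  proof -
    have "Max (S ` {..N}) \<in> S ` {..N}" by (rule Max_in) auto
    then obtain K where "K \<le> N" "S K = Max (S ` {..N})" by (metis atMost_iff imageE)
    then show thesis by (intro that[of K]) (auto intro!: Max_ge)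
  qed
  have max: "S n \<le> S K" for n using N[of n] K(2)[of n] K(2)[of 0] by (cases "n \<le> N") auto
  have "\<exists>n. stopped_walk L (\<lambda>j. x (K + j)) n \<le> - L" for L
  proof (rule ccontr)
    assume no: "\<not> ?thesis"
    have eq: "stopped_walk L (\<lambda>j. x (K + j)) n = S (K + n) - S K" for n
    proof (induction n)
      case (Suc n)
      have "- L < S (K + n) - S K" using no Suc by (metis not_le)
      then show ?case using Suc max[of "K + n"] by (simp add: S_def)
    qed simp
    have "eventually (\<lambda>n. S n \<le> S K - L) sequentially" using limS unfolding filterlim_at_bot by blast
    then obtain n where "n \<ge> K" "S n \<le> S K - L"
      unfolding eventually_sequentially by (metis nle_le)
    then have "stopped_walk L (\<lambda>j. x (K + j)) (n - K) \<le> - L" using eq[of "n - K"] by simp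
    then show False using no by blast
  qed
  then show ?thesis by blast
qed

text \<open>A gambler's ruin estimate. Restarted at any fixed time \<open>K\<close>, the stopped
  walk is bounded with mean zero, so it reaches \<open>- L\<close> with probability at most
  \<open>1 / (L + 1)\<close>. Reaching every such barrier is thus a null event for each of the
  countably many \<open>K\<close>, whereas a path diverging to minus infinity would do so for some
  \<open>K\<close>.\<close>

lemma (in prob_space) fair_walk_not_at_bot:
  fixes \<xi> :: "nat \<Rightarrow> 'a \<Rightarrow> real"
  assumes sub: "\<And>k. subalgebra M (G k)" and mono: "\<And>k. sets (G k) \<subseteq> sets (G (Suc k))"
    and meas: "\<And>k. \<xi> k \<in> borel_measurable (G (Suc k))"
    and range: "\<And>k \<omega>. \<omega> \<in> space M \<Longrightarrow> \<xi> k \<omega> \<in> {-1, 1}"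
    and fair: "\<And>k A. A \<in> sets (G k) \<Longrightarrow> prob (A \<inter> {\<omega> \<in> space M. \<xi> k \<omega> = 1}) = prob A / 2"
  shows "AE \<omega> in M. \<not> filterlim (\<lambda>n. \<Sum>j<n. \<xi> j \<omega>) at_bot sequentially"
proof -
  have sp: "space (G k) = space M" for k using sub by (auto simp: subalgebra_def)
  have up: "h \<in> borel_measurable (G k) \<Longrightarrow> h \<in> borel_measurable (G (Suc k))" for h :: "'a \<Rightarrow> real" and k
    using mono[of k] sp by (auto simp: measurable_def)
  have \<xi>M[measurable]: "\<xi> k \<in> borel_measurable M" for k using measurable_from_subalg[OF sub meas] .
  have "AE \<omega> in M. \<exists>L. \<forall>n. - L < stopped_walk L (\<lambda>j. \<xi> (K + j) \<omega>) n" for K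
  proof -
    define T where "T L n \<omega> = stopped_walk L (\<lambda>j. \<xi> (K + j) \<omega>) n" for L n \<omega>
    have TG: "T L n \<in> borel_measurable (G (K + n))" for L n
    proof (induction n)
      case 0
      then show ?case by (simp add: T_def[abs_def])
    next
      case (Suc n)
      have [measurable]: "T L n \<in> borel_measurable (G (Suc (K + n)))" by (intro up Suc)
      have [measurable]: "\<xi> (K + n) \<in> borel_measurable (G (Suc (K + n)))" by (rule meas)
      have "(\<lambda>\<omega>. T L n \<omega> + (if - L < T L n \<omega> \<and> T L n \<omega> < 1 then \<xi> (K + n) \<omega> else 0))
          \<in> borel_measurable (G (Suc (K + n)))" by measurable
      also have "(\<lambda>\<omega>. T L n \<omega> + (if - L < T L n \<omega> \<and> T L n \<omega> < 1 then \<xi> (K + n) \<omega> else 0)) = T L (Suc n)"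
        by (simp add: T_def fun_eq_iff)
      finally show ?case by simp
    qed
    have TM[measurable]: "T L n \<in> borel_measurable M" for L n
      using measurable_from_subalg[OF sub TG] .
    have reach: "prob (\<Union>n. {\<omega> \<in> space M. T L n \<omega> \<le> - L}) \<le> 1 / (L + 1)" if L: "L \<in> \<int>" "L \<ge> 1" for L
    proof -
      have bd: "\<omega> \<in> space M \<Longrightarrow> - L \<le> T L n \<omega> \<and> T L n \<omega> \<le> 1" for n \<omega>
        using stopped_walk_bounds[OF _ L, of "\<lambda>j. \<xi> (K + j) \<omega>" n] range unfolding T_def by blast
      have intT: "integrable M (T L n)" for n
        using bd[of _ n] L by (intro integrable_const_bound[of _ "L + 1"]) (fastforce intro!: AE_I2)+
      \<comment> \<open>The event \<open>A\<close> that the walk is still moving lies in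
        \<open>G (K + n)\<close>, so fairness applies to it: the next increment is \<open>1\<close>
        on half of \<open>A\<close> and \<open>-1\<close> on the other half.\<close>
      have ET: "expectation (T L n) = 0" for n
      proof (induction n)
        case 0
        then show ?case by (simp add: T_def)
      next
        case (Suc n)
        define A where "A = {\<omega> \<in> space M. - L < T L n \<omega> \<and> T L n \<omega> < 1}"
        let ?U = "{\<omega> \<in> space M. \<xi> (K + n) \<omega> = 1}"
        have AG: "A \<in> sets (G (K + n))"
        proof -
          have [measurable]: "T L n \<in> borel_measurable (G (K + n))" by (rule TG)
          have "{\<omega> \<in> space (G (K + n)). - L < T L n \<omega> \<and> T L n \<omega> < 1} \<in> sets (G (K + n))"
            by measurable
          then show ?thesis by (simp add: A_def sp)
        qed
        then have AM[measurable]: "A \<in> sets M" using sub by (auto simp: subalgebra_def)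
        have UM[measurable]: "?U \<in> sets M" by measurable
        have "expectation (T L (Suc n))
            = expectation (\<lambda>\<omega>. T L n \<omega> + (2 * indicat_real (A \<inter> ?U) \<omega> - indicat_real A \<omega>))"
        proof (rule Bochner_Integration.integral_cong)
          fix \<omega> assume "\<omega> \<in> space M"
          then show "T L (Suc n) \<omega> = T L n \<omega> + (2 * indicat_real (A \<inter> ?U) \<omega> - indicat_real A \<omega>)"
            using range[of \<omega> "K + n"] by (auto simp: T_def A_def indicator_def)
        qed simp
        also have "\<dots> = expectation (T L n) + (2 * prob (A \<inter> ?U) - prob A)"
          using intT by (simp add: emeasure_eq_measure less_top[symmetric])
        also have "\<dots> = 0" using Suc fair[OF AG] by simp
        finally show ?case .
      qed
      have Pn: "prob {\<omega> \<in> space M. T L n \<omega> \<le> - L} \<le> 1 / (L + 1)" for n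
      proof -
        let ?E = "{\<omega> \<in> space M. T L n \<omega> \<le> - L}"
        have E: "?E \<in> sets M" by measurable
        \<comment> \<open>The walk equals \<open>- L\<close> on \<open>?E\<close> and is at most
          \<open>1\<close> elsewhere; comparing means with \<open>ET\<close> yields the ruin
          probability.\<close>
        have "expectation (T L n) \<le> expectation (\<lambda>\<omega>. 1 - (L + 1) * indicat_real ?E \<omega>)"
        proof (rule integral_mono[OF intT])
          show "integrable M (\<lambda>\<omega>. 1 - (L + 1) * indicat_real ?E \<omega>)"
            using E by (simp add: emeasure_eq_measure less_top[symmetric])
          show "T L n \<omega> \<le> 1 - (L + 1) * indicat_real ?E \<omega>" if "\<omega> \<in> space M" for \<omega>
            using bd[OF that, of n] by (auto split: split_indicator)
        qed
        also have "\<dots> = 1 - (L + 1) * prob ?E"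
          using E by (simp add: emeasure_eq_measure less_top[symmetric] prob_space)
        finally have "prob ?E * (L + 1) \<le> 1" by (simp add: ET mult.commute)
        then show ?thesis using L by (simp add: pos_le_divide_eq)
      qed
      \<comment> \<open>Once at the lower barrier the walk stays there, so these events increase and
        the bound passes to their union.\<close>
      have "(\<lambda>n. prob {\<omega> \<in> space M. T L n \<omega> \<le> - L}) \<longlonglongrightarrow> prob (\<Union>n. {\<omega> \<in> space M. T L n \<omega> \<le> - L})"
      proof (rule finite_Lim_measure_incseq)
        have "T L (Suc n) \<omega> \<le> - L" if "T L n \<omega> \<le> - L" for n \<omega>
          using that unfolding T_def by (rule stopped_walk_stays)
        then show "incseq (\<lambda>n. {\<omega> \<in> space M. T L n \<omega> \<le> - L})"
          by (intro incseq_SucI) blast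
      qed auto
      then show ?thesis by (rule LIMSEQ_le_const2) (use Pn in blast)
    qed
    define Z where "Z = {\<omega> \<in> space M. \<forall>l::nat. \<exists>n. T (real (Suc l)) n \<omega> \<le> - real (Suc l)}"
    have ZM: "Z \<in> sets M" unfolding Z_def by measurable
    have "prob Z \<le> inverse (real (Suc l))" for l
    proof -
      have "prob Z \<le> prob (\<Union>n. {\<omega> \<in> space M. T (real (Suc l)) n \<omega> \<le> - real (Suc l)})"
        by (intro finite_measure_mono) (fastforce simp: Z_def, measurable)
      also have "\<dots> \<le> 1 / (real (Suc l) + 1)" by (rule reach) auto
      also have "\<dots> \<le> inverse (real (Suc l))" by (simp add: field_simps)
      finally show ?thesis .
    qed
    then have "prob Z \<le> 0" by (intro LIMSEQ_le_const[OF LIMSEQ_inverse_real_of_nat]) blast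
    then have "Z \<in> null_sets M" using ZM by (simp add: null_sets_def emeasure_eq_measure measure_le_0_iff)
    then show ?thesis
      by (rule AE_I') (unfold Z_def T_def not_less not_ex not_all, blast)
  qed
  then have "AE \<omega> in M. \<forall>K. \<exists>L. \<forall>n. - L < stopped_walk L (\<lambda>j. \<xi> (K + j) \<omega>) n"
    unfolding AE_all_countable by blast
  then show ?thesis
  proof eventually_elim
    case (elim \<omega>)
    show ?case
    proof
      assume "filterlim (\<lambda>n. \<Sum>j<n. \<xi> j \<omega>) at_bot sequentially"
      from walk_at_bot_reaches[OF this] obtain K
        where "\<forall>L. \<exists>n. stopped_walk L (\<lambda>j. \<xi> (K + j) \<omega>) n \<le> - L" by blast
      with elim show False by (meson not_le)
    qed
  qed
qed

subsection \<open>Paths of the algorithm\<close>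

context dse
begin

section \<open>Filtration and measurability\<close>

abbreviation "F \<equiv> dse_dir_algebra M mbar G D"

lemma D_measurable [measurable]: "m \<in> {1..mbar} \<Longrightarrow> D k m \<in> borel_measurable M"
  using D_indep[of k] by (auto simp: cond_indep_vars_def)

lemma space_G: "space (G k) = space M"
  using subalgebra_G[of k] by (simp add: subalgebra_def)

lemma generators_F_subset:
  "sets (G k) \<union> {D k m -` B \<inter> space M | m B. m \<in> {1..mbar} \<and> B \<in> sets borel} \<subseteq> sets M"
  using subalgebra_G[of k] measurable_sets[OF D_measurable] by (auto simp: subalgebra_def)

lemma space_F: "space (F k) = space M"
  unfolding dse_dir_algebra_def
  using order_trans[OF generators_F_subset sets.space_closed] by (rule space_measure_of)

lemma sets_F: "sets (F k) = sigma_sets (space M)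
    (sets (G k) \<union> {D k m -` B \<inter> space M | m B. m \<in> {1..mbar} \<and> B \<in> sets borel})"
  unfolding dse_dir_algebra_def
  using order_trans[OF generators_F_subset sets.space_closed] by (rule sets_measure_of)

lemma subalgebra_F: "subalgebra M (F k)"
  unfolding subalgebra_def space_F sets_F
  using generators_F_subset by (simp add: sets.sigma_sets_subset)

lemma subalgebra_F_G: "subalgebra (F k) (G k)"
  unfolding subalgebra_def space_F space_G sets_F by auto

lemma D_measurable_F: "m \<in> {1..mbar} \<Longrightarrow> D k m \<in> borel_measurable (F k)"
  by (intro measurableI) (auto simp: space_F sets_F intro!: sigma_sets.Basic)

lemma sets_G_Suc: "sets (G k) \<subseteq> sets (G (Suc k))"
  using subalgebra_F_G[of k] subalgebra_Suc[of k] by (auto simp: subalgebra_def)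

lemma X_measurable_M [measurable]: "X k \<in> borel_measurable M"
  by (rule measurable_from_subalg[OF subalgebra_G X_measurable])

lemma Delta_measurable_M [measurable]: "\<Delta> k \<in> borel_measurable M"
  by (rule measurable_from_subalg[OF subalgebra_G Delta_measurable])

lemma Delta_measurable_F: "\<Delta> k \<in> borel_measurable (F k)"
  by (rule measurable_from_subalg[OF subalgebra_F_G Delta_measurable])

lemma fc_measurable_M [measurable]: "fc k \<in> borel_measurable M"
  by (rule measurable_from_subalg[OF subalgebra_G fc_measurable])

lemma fe_measurable_M [measurable]:
  "m \<in> {1..mbar} \<Longrightarrow> i \<le> ibar \<Longrightarrow> fe k m i \<in> borel_measurable M"
  by (rule measurable_from_subalg[OF subalgebra_G fe_measurable])

lemma continuous_f: "continuous_on UNIV f"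
  by (rule lipschitz_near_imp_continuous[OF locally_lipschitz])

lemma f_measurable [measurable]: "f \<in> borel_measurable borel"
  by (rule borel_measurable_continuous_onI[OF continuous_f])

lemma trial_measurable [measurable]:
  "m \<in> {1..mbar} \<Longrightarrow> (\<lambda>\<omega>. dse_trial \<gamma> X \<Delta> D k m i \<omega>) \<in> borel_measurable M"
  unfolding dse_trial_def dse_step_def by measurable

section \<open>The largest estimation error of an iteration\<close>

abbreviation "Emax \<equiv> dse_Emax \<gamma> mbar ibar f X \<Delta> D fc fe"

lemma Emax_measurable [measurable]: "Emax k \<in> borel_measurable M"
proof -
  have "(\<lambda>\<omega>. Max ((\<lambda>i. \<bar>fc k \<omega> - fe k m i \<omega> - (f (X k \<omega>) - f (dse_trial \<gamma> X \<Delta> D k m i \<omega>))\<bar>) ` {0..ibar}))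
      \<in> borel_measurable M" if "m \<in> {1..mbar}" for m
    using that by (intro borel_measurable_Max) auto
  then show ?thesis
    unfolding dse_Emax_def[abs_def] by (intro borel_measurable_Max) auto
qed

lemma Emax_ge:
  assumes "m \<in> {1..mbar}" "i \<le> ibar"
  shows "\<bar>(fc k \<omega> - fe k m i \<omega>) - (f (X k \<omega>) - f (dse_trial \<gamma> X \<Delta> D k m i \<omega>))\<bar> \<le> Emax k \<omega>"
  unfolding dse_Emax_def using assms
  by (intro order_trans[OF _ Max_ge[OF _ imageI[of m]]] Max_ge) auto

lemma Emax_nonneg: "0 \<le> Emax k \<omega>"
  using Emax_ge[of 1 0 k \<omega>] mbar by (auto intro: order_trans[OF abs_ge_zero])

text \<open>Turns the update rules into a case split for pathwise arguments. The selected direction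
  is the least index passing the test, and the set of accepted extrapolations contains 0, so its
  maximum \<open>h\<close> belongs to it.\<close>

lemma step_cases [consumes 1, case_names unsuccessful successful]:
  assumes \<omega>: "\<omega> \<in> space M"
  obtains "H k \<omega> = -1" "Dsel k \<omega> = D k mbar \<omega>" "\<forall>m\<in>{1..mbar}. \<not> dse_decrease p \<theta> \<gamma> \<Delta> fc fe k m 0 \<omega>"
      "X (Suc k) \<omega> = X k \<omega>" "\<Delta> (Suc k) \<omega> = \<gamma> * \<Delta> k \<omega>"
  | m h where "m \<in> {1..mbar}" "h \<le> ibar" "H k \<omega> = int h" "dse_decrease p \<theta> \<gamma> \<Delta> fc fe k m h \<omega>"
      "X (Suc k) \<omega> = dse_trial \<gamma> X \<Delta> D k m h \<omega>"
      "\<Delta> (Suc k) \<omega> = dse_step \<gamma> (\<Delta> k \<omega>) (max 1 h)"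
proof (cases "\<forall>m\<in>{1..mbar}. \<not> dse_decrease p \<theta> \<gamma> \<Delta> fc fe k m 0 \<omega>")
  case True
  then show thesis using unsuccessful[OF \<omega> True] that(1) by blast
next
  case False
  let ?dec = "\<lambda>m i. dse_decrease p \<theta> \<gamma> \<Delta> fc fe k m i \<omega>"
  define m where "m = (LEAST m. m \<in> {1..mbar} \<and> ?dec m 0)"
  have m: "m \<in> {1..mbar}" "?dec m 0"
    using False LeastI_ex[of "\<lambda>m. m \<in> {1..mbar} \<and> ?dec m 0"] unfolding m_def by blast+
  have "\<forall>m'\<in>{1..<m}. \<not> ?dec m' 0"
    using not_less_Least[of _ "\<lambda>m. m \<in> {1..mbar} \<and> ?dec m 0"] m(1) unfolding m_def[symmetric] by fastforce
  note s = successful[OF \<omega> m this]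
  define h where "h = Max {j \<in> {0..ibar}. \<forall>i\<in>{0..j}. ?dec m i}"
  have "h \<in> {j \<in> {0..ibar}. \<forall>i\<in>{0..j}. ?dec m i}"
    unfolding h_def
  proof (rule Max_in)
    have "0 \<in> {j \<in> {0..ibar}. \<forall>i\<in>{0..j}. ?dec m i}" using m(2) by simp
    then show "{j \<in> {0..ibar}. \<forall>i\<in>{0..j}. ?dec m i} \<noteq> {}" by blast
  qed simp
  moreover have "H k \<omega> = int h" using s by (simp add: h_def)
  \<comment> \<open>For \<open>h = 0\<close> the step size still grows by one factor
    \<open>1 / \<gamma>\<close>, so the index \<open>max 1 h\<close> covers both update
    rules.\<close>
  moreover have "\<Delta> (Suc k) \<omega> = dse_step \<gamma> (\<Delta> k \<omega>) (max 1 h)"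
    using s calculation(2) by (cases "h = 0") (auto simp: dse_step_def max_def)
  ultimately show thesis using s m(1)
    by (intro that(2)[of m h]) (auto simp: dse_trial_def)
qed

section \<open>Bounds and possible values of the step size\<close>

lemma dse_step_pos: "\<omega> \<in> space M \<Longrightarrow> dse_step \<gamma> (\<Delta> k \<omega>) i > 0"
  using Delta_pos gamma by (simp add: dse_step_def)

lemma dse_step_mono: "\<omega> \<in> space M \<Longrightarrow> i \<le> j \<Longrightarrow> dse_step \<gamma> (\<Delta> k \<omega>) i \<le> dse_step \<gamma> (\<Delta> k \<omega>) j"
  unfolding dse_step_def using Delta_pos[of \<omega> k] gamma
  by (intro divide_left_mono power_decreasing) auto

lemma Delta_Suc_ge:
  assumes \<omega>: "\<omega> \<in> space M"
  shows "\<gamma> * \<Delta> k \<omega> \<le> \<Delta> (Suc k) \<omega>"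
  using \<omega>
proof (cases rule: step_cases[of \<omega> k])
  case (successful m h)
  have "\<gamma> * \<Delta> k \<omega> \<le> dse_step \<gamma> (\<Delta> k \<omega>) 0"
    using gamma Delta_pos[OF \<omega>, of k] by (simp add: dse_step_def)
  also have "\<dots> \<le> dse_step \<gamma> (\<Delta> k \<omega>) (max 1 h)" using \<omega> by (intro dse_step_mono) auto
  finally show ?thesis using successful by simp
qed simp

lemma Delta_Suc_le:
  assumes \<omega>: "\<omega> \<in> space M"
  shows "\<Delta> (Suc k) \<omega> \<le> \<Delta> k \<omega> / \<gamma> ^ Suc ibar"
  using \<omega>
proof (cases rule: step_cases[of \<omega> k])
  case unsuccessful
  have "\<gamma> * \<Delta> k \<omega> \<le> dse_step \<gamma> (\<Delta> k \<omega>) 0"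
    using gamma Delta_pos[OF \<omega>, of k] by (simp add: dse_step_def)
  also have "\<dots> \<le> dse_step \<gamma> (\<Delta> k \<omega>) (Suc ibar)" using \<omega> by (intro dse_step_mono) auto
  finally show ?thesis using unsuccessful by (simp add: dse_step_def)
next
  case (successful m h)
  have "dse_step \<gamma> (\<Delta> k \<omega>) (max 1 h) \<le> dse_step \<gamma> (\<Delta> k \<omega>) (Suc ibar)"
    using \<omega> successful by (intro dse_step_mono) auto
  then show ?thesis using successful by (simp add: dse_step_def)
qed

text \<open>A deterministic bound for each fixed \<open>k\<close>, which gives integrability of the
  powers of the step size; it grows with \<open>k\<close>.\<close>

lemma Delta_le: "\<omega> \<in> space M \<Longrightarrow> \<Delta> k \<omega> \<le> \<delta>0 / (\<gamma> ^ Suc ibar) ^ k"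
proof (induction k)
  case (Suc k)
  then have "\<Delta> k \<omega> / \<gamma> ^ Suc ibar \<le> \<delta>0 / (\<gamma> ^ Suc ibar) ^ k / \<gamma> ^ Suc ibar"
    using gamma by (intro divide_right_mono) auto
  then show ?case using Delta_Suc_le[OF Suc.prems, of k] by (simp add: mult.commute)
qed (simp add: init)

text \<open>Every update multiplies by an integer power of \<gamma>. The resulting countable range
  is what \<open>emeasure_tail_le\<close> requires.\<close>

lemma Delta_in_lattice: "\<omega> \<in> space M \<Longrightarrow> \<Delta> k \<omega> \<in> range (\<lambda>z::int. \<delta>0 * \<gamma> powi z)"
proof (induction k)
  case 0
  have "\<delta>0 = \<delta>0 * \<gamma> powi 0" by simp
  then show ?case unfolding init(2)[OF 0] by (rule range_eqI)
next
  case (Suc k)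
  then obtain z where z: "\<Delta> k \<omega> = \<delta>0 * \<gamma> powi z" by auto
  show ?case using Suc.prems
  proof (cases rule: step_cases[of \<omega> k])
    case unsuccessful
    then have "\<Delta> (Suc k) \<omega> = \<delta>0 * \<gamma> powi (z + 1)" using gamma by (simp add: z power_int_add)
    then show ?thesis by blast
  next
    case (successful m h)
    then have "\<Delta> (Suc k) \<omega> = \<delta>0 * \<gamma> powi (z - int (max 1 h))"
      using gamma by (simp add: z power_int_diff dse_step_def)
    then show ?thesis by blast
  qed
qed

lemma unsuccessfulD:
  assumes "\<omega> \<in> space M" "H k \<omega> = -1"
  shows "Dsel k \<omega> = D k mbar \<omega>" "\<not> dse_decrease p \<theta> \<gamma> \<Delta> fc fe k mbar 0 \<omega>"
proof -
  have "Dsel k \<omega> = D k mbar \<omega> \<and> \<not> dse_decrease p \<theta> \<gamma> \<Delta> fc fe k mbar 0 \<omega>"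
    using assms(1) by (cases rule: step_cases[of \<omega> k]) (use assms(2) mbar in auto)
  then show "Dsel k \<omega> = D k mbar \<omega>" "\<not> dse_decrease p \<theta> \<gamma> \<Delta> fc fe k mbar 0 \<omega>" by auto
qed

section \<open>Almost sure properties of the sampled directions\<close>

lemma AE_norm_D:
  assumes m: "m \<in> {1..mbar}"
  shows "AE \<omega> in M. norm (D k m \<omega>) = 1"
proof -
  have "prob (space M \<inter> {\<omega> \<in> space M. D k m \<omega> \<in> sphere 0 1}) = 1"
    using prob_Int_cond_law[OF subalgebra_G[of k] D_uniform[OF m], of "space M" "sphere 0 1"]
      space_G[of k] sets.top[of "G k"]
    by (simp add: sets_sphere_uniform measure_sphere_uniform_sphere prob_space)
  then show ?thesis using m
    by (subst (asm) prob_eq_1) auto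
qed

text \<open>Given \<open>G k\<close>, the sign of the first direction along \<open>b\<close> is a
  fair coin, by symmetry of the uniform law.\<close>

lemma AE_direction_walk_not_at_bot:
  assumes dim: "DIM('a) = 1" and b: "norm b = 1"
  shows "AE \<omega> in M. \<not> filterlim (\<lambda>n. \<Sum>j<n. if 0 < D j 1 \<omega> \<bullet> b then 1 else - 1 :: real) at_bot sequentially"
proof (rule fair_walk_not_at_bot[where G = G, OF subalgebra_G sets_G_Suc])
  have 1: "1 \<in> {1..mbar}" using mbar by simp
  fix k
  have [measurable]: "D k 1 \<in> borel_measurable (G (Suc k))"
    by (rule measurable_from_subalg[OF subalgebra_Suc D_measurable_F[OF 1]])
  show "(\<lambda>\<omega>. if 0 < D k 1 \<omega> \<bullet> b then 1 else - 1 :: real) \<in> borel_measurable (G (Suc k))"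
    by measurable
  fix A assume A: "A \<in> sets (G k)"
  have "{\<omega> \<in> space M. (if 0 < D k 1 \<omega> \<bullet> b then 1 else - 1 :: real) = 1}
      = {\<omega> \<in> space M. D k 1 \<omega> \<in> {x. 0 < x \<bullet> b}}" by auto
  then show "prob (A \<inter> {\<omega> \<in> space M. (if 0 < D k 1 \<omega> \<bullet> b then 1 else - 1 :: real) = 1}) = prob A / 2"
    using prob_Int_cond_law[OF subalgebra_G[of k] D_uniform[OF 1] A, of "{x. 0 < x \<bullet> b}"]
    by (simp add: sets_sphere_uniform measure_sphere_uniform_half[OF dim b])
qed auto

end

subsection \<open>Summability of the step sizes\<close>

locale dse_tame = dse +
  fixes \<eta> c_max \<epsilon> :: real and C
  assumes compact_C: "compact C" and X_in_C: "\<And>k. AE \<omega> in M. X k \<omega> \<in> C"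
    and eps_pos: "\<epsilon> > 0"
    and tail_fc: "\<And>k \<alpha>. \<alpha> \<ge> \<epsilon> \<Longrightarrow> AE \<omega> in M. cprob M (F k)
            {\<omega> \<in> space M. \<bar>fc k \<omega> - f (X k \<omega>)\<bar> \<ge> \<alpha> * \<Delta> k \<omega> powr p} \<omega>
              \<le> \<epsilon> / \<alpha> powr (p / (p - 1))"
    and tail_fe: "\<And>k m \<alpha>. m \<in> {1..mbar} \<Longrightarrow> \<alpha> \<ge> \<epsilon> \<Longrightarrow> AE \<omega> in M. cprob M (F k)
            {\<omega> \<in> space M. \<bar>fe k m 0 \<omega> - f (dse_trial \<gamma> X \<Delta> D k m 0 \<omega>)\<bar> \<ge> \<alpha> * \<Delta> k \<omega> powr p} \<omega>
              \<le> \<epsilon> / \<alpha> powr (p / (p - 1))"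
    and c_max_pos: "c_max > 0"
    and c_max: "\<And>k. AE \<omega> in M. nn_cond_exp M (F k) (\<lambda>\<omega>. ennreal (Emax k \<omega>)) \<omega>
           \<le> ennreal (c_max * \<Delta> k \<omega> powr p)"
    and eta: "\<eta> > 0" "\<eta> > c_max / (1 - \<gamma> powr p)"
    and theta_eta: "\<theta> \<ge> \<eta> * max 1 (\<gamma> powr (- p) - \<gamma> powr p)"
begin

section \<open>Lyapunov function and its expected decrease\<close>

definition \<Phi> :: "nat \<Rightarrow> 'a \<Rightarrow> real" where
  "\<Phi> k \<omega> = f (X k \<omega>) + \<eta> * \<Delta> k \<omega> powr p"

lemma gamma_powr: "0 < \<gamma> powr p" "\<gamma> powr p < 1"
  using gamma p powr_less_mono2[of p \<gamma> 1] by auto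

text \<open>An unsuccessful step keeps \<open>f\<close> and shrinks the penalty, giving the stated
  drop. On success the two arguments of the maximum in \<open>theta_eta\<close> serve the two update
  rules. For \<open>h \<ge> 1\<close> the new step size is the accepted one, so
  \<open>\<theta> \<ge> \<eta>\<close> pays for the new penalty and the old penalty covers the drop.
  For \<open>h = 0\<close> the step size grows beyond the accepted one, and expansion and drop
  together cost \<open>\<eta> * (\<gamma> powr (- p) - \<gamma> powr p)\<close>.\<close>

lemma lyapunov_decrease:
  assumes \<omega>: "\<omega> \<in> space M"
  shows "\<Phi> (Suc k) \<omega> + \<eta> * (1 - \<gamma> powr p) * \<Delta> k \<omega> powr p \<le> \<Phi> k \<omega> + Emax k \<omega>"
  using \<omega>
proof (cases rule: step_cases[of \<omega> k])
  case unsuccessful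
  then show ?thesis
    using Emax_nonneg[of k \<omega>] gamma Delta_pos[OF \<omega>, of k]
    by (simp add: \<Phi>_def powr_mult algebra_simps)
next
  case (successful m h)
  let ?\<delta> = "dse_step \<gamma> (\<Delta> k \<omega>) h" and ?d = "\<Delta> k \<omega> powr p"
  have "\<eta> * 1 \<le> \<eta> * max 1 (\<gamma> powr (- p) - \<gamma> powr p)"
    "\<eta> * (\<gamma> powr (- p) - \<gamma> powr p) \<le> \<eta> * max 1 (\<gamma> powr (- p) - \<gamma> powr p)"
    using eta(1) by (auto intro!: mult_left_mono)
  then have th: "\<eta> \<le> \<theta>" "\<eta> * (\<gamma> powr (- p) - \<gamma> powr p) \<le> \<theta>"
    using theta_eta by linarith+
  have dec: "f (X (Suc k) \<omega>) - f (X k \<omega>) \<le> Emax k \<omega> - \<theta> * ?\<delta> powr p"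
    using Emax_ge[OF successful(1,2), of k \<omega>] successful(4,5) by (simp add: dse_decrease_def)
  show ?thesis
  proof (cases "h = 0")
    case True
    have "\<Delta> (Suc k) \<omega> = \<Delta> k \<omega> / \<gamma>" using True successful(6) by (simp add: dse_step_def)
    then have "\<Delta> (Suc k) \<omega> powr p = ?d * \<gamma> powr (- p)"
      using gamma Delta_pos[OF \<omega>, of k] by (simp add: powr_divide powr_minus_divide)
    moreover have "?\<delta> powr p = ?d" using True by (simp add: dse_step_def)
    moreover have "\<eta> * (\<gamma> powr (- p) - \<gamma> powr p) * ?d \<le> \<theta> * ?d"
      using th(2) by (intro mult_right_mono) auto
    ultimately show ?thesis using dec by (simp add: \<Phi>_def algebra_simps)
  next
    case False
    then have "\<Delta> (Suc k) \<omega> = ?\<delta>" using successful(6) by (simp add: max_def)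
    moreover have "\<eta> * ?\<delta> powr p \<le> \<theta> * ?\<delta> powr p" using th(1) by (intro mult_right_mono) auto
    moreover have "\<eta> * (1 - \<gamma> powr p) * ?d \<le> \<eta> * ?d"
      using eta(1) gamma_powr by (intro mult_right_mono) auto
    ultimately show ?thesis using dec by (simp add: \<Phi>_def)
  qed
qed

lemma f_X_bounded:
  obtains B where "AE \<omega> in M. \<forall>k. \<bar>f (X k \<omega>)\<bar> \<le> B"
proof -
  have "bounded (f ` C)"
    using compact_C continuous_on_subset[OF continuous_f]
    by (intro compact_imp_bounded compact_continuous_image) auto
  then obtain B where B: "\<And>x. x \<in> C \<Longrightarrow> \<bar>f x\<bar> \<le> B"
    unfolding bounded_iff by auto
  have "AE \<omega> in M. \<forall>k. X k \<omega> \<in> C" using X_in_C by (simp add: AE_all_countable)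
  then have "AE \<omega> in M. \<forall>k. \<bar>f (X k \<omega>)\<bar> \<le> max 0 B"
    by eventually_elim (use B in \<open>auto simp: le_max_iff_disj\<close>)
  then show thesis by (rule that)
qed

lemma integrable_Delta_powr: "integrable M (\<lambda>\<omega>. \<Delta> k \<omega> powr p)"
proof (rule integrable_const_bound[of _ "(\<delta>0 / (\<gamma> ^ Suc ibar) ^ k) powr p"])
  show "AE \<omega> in M. norm (\<Delta> k \<omega> powr p) \<le> (\<delta>0 / (\<gamma> ^ Suc ibar) ^ k) powr p"
  proof (rule AE_I2)
    fix \<omega> assume "\<omega> \<in> space M"
    from Delta_le[OF this, of k] Delta_pos[OF this, of k]
    show "norm (\<Delta> k \<omega> powr p) \<le> (\<delta>0 / (\<gamma> ^ Suc ibar) ^ k) powr p"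
      using p by (simp add: powr_mono2)
  qed
qed measurable

lemma integrable_f_X: "integrable M (\<lambda>\<omega>. f (X k \<omega>))"
proof -
  obtain B where "AE \<omega> in M. \<forall>k. \<bar>f (X k \<omega>)\<bar> \<le> B" using f_X_bounded by blast
  then have "AE \<omega> in M. norm (f (X k \<omega>)) \<le> B" by eventually_elim simp
  then show ?thesis by (rule integrable_const_bound) measurable
qed

lemma integrable_\<Phi>: "integrable M (\<Phi> k)"
  unfolding \<Phi>_def[abs_def] using integrable_f_X integrable_Delta_powr by auto

text \<open>The nonnegative conditional expectation makes sense without integrability of
  \<open>Emax k\<close>, which is then derived from this bound.\<close>

lemma nn_integral_Emax: "(\<integral>\<^sup>+\<omega>. Emax k \<omega> \<partial>M) \<le> ennreal (c_max * expectation (\<lambda>\<omega>. \<Delta> k \<omega> powr p))"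
proof -
  interpret sub: sigma_finite_subalgebra M "F k"
    using subalgebra_F by (intro finite_measure_subalgebra_is_sigma_finite finite_measure_subalgebra.intro
      finite_measure_subalgebra_axioms.intro finite_measure_axioms)
  have "(\<integral>\<^sup>+\<omega>. Emax k \<omega> \<partial>M) = (\<integral>\<^sup>+\<omega>. nn_cond_exp M (F k) (\<lambda>\<omega>. ennreal (Emax k \<omega>)) \<omega> \<partial>M)"
    using sub.nn_cond_exp_intg[of "\<lambda>_. 1" "\<lambda>\<omega>. ennreal (Emax k \<omega>)"] by simp
  also have "\<dots> \<le> (\<integral>\<^sup>+\<omega>. ennreal (c_max * \<Delta> k \<omega> powr p) \<partial>M)"
    by (rule nn_integral_mono_AE[OF c_max])
  also have "\<dots> = ennreal (expectation (\<lambda>\<omega>. c_max * \<Delta> k \<omega> powr p))"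
    using integrable_Delta_powr c_max_pos by (intro nn_integral_eq_integral) auto
  finally show ?thesis by simp
qed

lemma integrable_Emax: "integrable M (Emax k)"
  using nn_integral_Emax[of k] Emax_nonneg
  by (intro integrableI_nonneg) (auto simp: less_top[symmetric] top_unique)

lemma expectation_Emax: "expectation (Emax k) \<le> c_max * expectation (\<lambda>\<omega>. \<Delta> k \<omega> powr p)"
proof -
  have "ennreal (expectation (Emax k)) \<le> ennreal (c_max * expectation (\<lambda>\<omega>. \<Delta> k \<omega> powr p))"
    using nn_integral_Emax[of k] nn_integral_eq_integral[OF integrable_Emax[of k]] Emax_nonneg by simp
  then show ?thesis
    using c_max_pos by (subst (asm) ennreal_le_iff) (auto intro!: mult_nonneg_nonneg integral_nonneg_AE)
qed

text \<open>The expected decrease telescopes, and the means of \<Phi> are bounded below because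
  \<open>f\<close> is bounded on the compact set.\<close>

lemma summable_expectation_Delta: "summable (\<lambda>k. expectation (\<lambda>\<omega>. \<Delta> k \<omega> powr p))"
proof -
  obtain B where B: "AE \<omega> in M. \<forall>k. \<bar>f (X k \<omega>)\<bar> \<le> B" using f_X_bounded by blast
  define a where "a k = expectation (\<lambda>\<omega>. \<Delta> k \<omega> powr p)" for k
  have a: "a k \<ge> 0" for k unfolding a_def by (intro integral_nonneg_AE) auto
  \<comment> \<open>The net decrease rate after paying for the mean error; \<open>eta(2)\<close>
    says precisely that it is positive.\<close>
  define \<rho> where "\<rho> = \<eta> * (1 - \<gamma> powr p) - c_max"
  have \<rho>: "\<rho> > 0" using eta(2) gamma_powr by (simp add: \<rho>_def field_simps)
  have step: "expectation (\<Phi> (Suc k)) + \<rho> * a k \<le> expectation (\<Phi> k)" for k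
  proof -
    have "expectation (\<lambda>\<omega>. \<Phi> (Suc k) \<omega> + \<eta> * (1 - \<gamma> powr p) * \<Delta> k \<omega> powr p)
        \<le> expectation (\<lambda>\<omega>. \<Phi> k \<omega> + Emax k \<omega>)"
      using integrable_\<Phi> integrable_Delta_powr integrable_Emax
      by (intro integral_mono lyapunov_decrease) auto
    then have "expectation (\<Phi> (Suc k)) + \<eta> * (1 - \<gamma> powr p) * a k \<le> expectation (\<Phi> k) + expectation (Emax k)"
      using integrable_\<Phi> integrable_Delta_powr integrable_Emax by (simp add: a_def)
    then show ?thesis using expectation_Emax[of k] by (simp add: \<rho>_def a_def algebra_simps)
  qed
  have "(\<Sum>k<n. \<rho> * a k) \<le> expectation (\<Phi> 0) - expectation (\<Phi> n)" for n
  proof (induction n)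
    case (Suc n)
    then show ?case using step[of n] by simp
  qed simp
  moreover have "- B \<le> expectation (\<Phi> n)" for n
  proof -
    have "expectation (\<lambda>_. - B) \<le> expectation (\<Phi> n)"
      using B eta(1) integrable_\<Phi>
      by (intro integral_mono_AE)
        (auto simp: \<Phi>_def abs_le_iff minus_le_iff elim!: eventually_mono intro!: add_increasing2)
    then show ?thesis by (simp add: prob_space)
  qed
  ultimately have "(\<Sum>k<n. \<rho> * a k) \<le> expectation (\<Phi> 0) + B" for n by (smt (verit))
  then have "summable (\<lambda>k. \<rho> * a k)"
    using a \<rho> by (intro summableI_nonneg_bounded) auto
  then show ?thesis using \<rho> by (simp add: a_def summable_cmult_iff)
qed

section \<open>Almost sure asymptotics of step sizes, values and errors\<close>

lemma AE_Delta_tendsto_0: "AE \<omega> in M. (\<lambda>k. \<Delta> k \<omega>) \<longlonglongrightarrow> 0"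
proof -
  have "AE \<omega> in M. summable (\<lambda>k. \<Delta> k \<omega> powr p)"
    using integrable_Delta_powr summable_expectation_Delta by (intro AE_summable_of_expectation) auto
  then show ?thesis
  proof (rule AE_mp, intro AE_I2 impI)
    fix \<omega> assume \<omega>: "\<omega> \<in> space M" and "summable (\<lambda>k. \<Delta> k \<omega> powr p)"
    then have "(\<lambda>k. \<Delta> k \<omega> powr p) \<longlonglongrightarrow> 0" by (intro summable_LIMSEQ_zero)
    then have "(\<lambda>k. (\<Delta> k \<omega> powr p) powr (1 / p)) \<longlonglongrightarrow> 0 powr (1 / p)"
      using p by (intro tendsto_powr') auto
    then show "(\<lambda>k. \<Delta> k \<omega>) \<longlonglongrightarrow> 0"
      using p Delta_pos[OF \<omega>] by (simp add: powr_powr less_imp_le)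
  qed
qed

text \<open>The compensated sequence \<open>\<Phi>\<close> minus the partial sums of \<open>Emax\<close> is nonincreasing and bounded
  below along almost every path.\<close>

lemma AE_convergent_f_X: "AE \<omega> in M. convergent (\<lambda>k. f (X k \<omega>))"
proof -
  obtain B where B: "AE \<omega> in M. \<forall>k. \<bar>f (X k \<omega>)\<bar> \<le> B" using f_X_bounded by blast
  have "summable (\<lambda>k. expectation (Emax k))"
    by (rule summable_comparison_test'[OF summable_mult[OF summable_expectation_Delta]])
      (use expectation_Emax Emax_nonneg in \<open>auto intro!: integral_nonneg_AE\<close>)
  then have "AE \<omega> in M. summable (\<lambda>k. Emax k \<omega>)"
    using integrable_Emax Emax_nonneg by (intro AE_summable_of_expectation) auto
  moreover note AE_Delta_tendsto_0 B AE_space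
  ultimately show ?thesis
  proof eventually_elim
    case (elim \<omega>)
    define T where "T n = \<Phi> n \<omega> - (\<Sum>k<n. Emax k \<omega>)" for n
    have "T (Suc n) \<le> T n" for n
    proof -
      have "0 \<le> \<eta> * (1 - \<gamma> powr p) * \<Delta> n \<omega> powr p" using eta(1) gamma_powr by simp
      then show ?thesis using lyapunov_decrease[OF elim(4), of n] by (simp add: T_def)
    qed
    then have "decseq T" by (rule decseq_SucI)
    moreover have "- B - (\<Sum>k. Emax k \<omega>) \<le> T n" for n
    proof -
      have "(\<Sum>k<n. Emax k \<omega>) \<le> (\<Sum>k. Emax k \<omega>)"
        using elim(1) Emax_nonneg by (intro sum_le_suminf) auto
      moreover have "- B \<le> \<Phi> n \<omega>"
        using elim(3) eta(1) by (auto simp: \<Phi>_def abs_le_iff minus_le_iff intro!: add_increasing2)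
      ultimately show ?thesis by (simp add: T_def)
    qed
    ultimately obtain l where l: "T \<longlonglongrightarrow> l" using decseq_convergent by metis
    have "(\<lambda>k. \<Delta> k \<omega> powr p) \<longlonglongrightarrow> 0 powr p"
      using elim(2) p Delta_pos[OF elim(4)] by (intro tendsto_powr') (auto simp: less_imp_le)
    then have d: "(\<lambda>k. \<eta> * \<Delta> k \<omega> powr p) \<longlonglongrightarrow> 0" by (simp add: tendsto_mult_right_zero)
    \<comment> \<open>Adding back the error sums and removing the penalty recovers
      \<open>f (X n)\<close> from \<open>T n\<close>.\<close>
    have "(\<lambda>n. T n + (\<Sum>k<n. Emax k \<omega>) - \<eta> * \<Delta> n \<omega> powr p) \<longlonglongrightarrow> l + (\<Sum>k. Emax k \<omega>) - 0"
      by (intro tendsto_intros l d summable_LIMSEQ elim)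
    then show ?case by (intro convergentI) (simp add: T_def \<Phi>_def)
  qed
qed

text \<open>By \<open>emeasure_tail_le\<close> the probability of an error of size
  \<open>e * \<Delta> k\<close> is at most a constant times the mean of
  \<open>\<Delta> k powr p\<close>, which is summable, so Borel--Cantelli applies.\<close>

lemma AE_error_small:
  fixes Y :: "nat \<Rightarrow> 'a \<Rightarrow> real"
  assumes Y: "\<And>k. Y k \<in> borel_measurable M"
    and tail: "\<And>k \<alpha>. \<alpha> \<ge> \<epsilon> \<Longrightarrow> AE \<omega> in M. cprob M (F k) {\<omega> \<in> space M. Y k \<omega> \<ge> \<alpha> * \<Delta> k \<omega> powr p} \<omega>
              \<le> \<epsilon> / \<alpha> powr (p / (p - 1))"
  shows "AE \<omega> in M. \<forall>e>0. \<forall>\<^sub>F k in sequentially. Y k \<omega> < e * \<Delta> k \<omega>"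
proof -
  have *: "AE \<omega> in M. \<forall>\<^sub>F k in sequentially. Y k \<omega> < e * \<Delta> k \<omega>" if e: "e > 0" for e
  proof -
    let ?A = "\<lambda>k. {\<omega> \<in> space M. Y k \<omega> \<ge> e * \<Delta> k \<omega>}"
    define K where "K = (\<epsilon> + \<epsilon> powr (p / (p - 1))) / e powr (p / (p - 1))"
    have K: "K \<ge> 0" using eps_pos by (simp add: K_def)
    have "measure M (?A k) \<le> K * expectation (\<lambda>\<omega>. \<Delta> k \<omega> powr p)" for k
    proof -
      have "emeasure M (?A k) \<le> (\<integral>\<^sup>+\<omega>. ennreal (K * \<Delta> k \<omega> powr p) \<partial>M)"
        unfolding K_def
        by (rule emeasure_tail_le[OF subalgebra_F Y Delta_measurable_F Delta_pos _ Delta_in_lattice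
              p(1) eps_pos e tail]) auto
      also have "\<dots> = ennreal (expectation (\<lambda>\<omega>. K * \<Delta> k \<omega> powr p))"
        using integrable_Delta_powr K by (intro nn_integral_eq_integral) auto
      finally show ?thesis
        using K by (simp add: emeasure_eq_measure ennreal_le_iff mult_nonneg_nonneg integral_nonneg_AE)
    qed
    then have "summable (\<lambda>k. measure M (?A k))"
      by (intro summable_comparison_test'[OF summable_mult[OF summable_expectation_Delta]]) auto
    then have "AE \<omega> in M. \<forall>\<^sub>F k in sequentially. \<omega> \<in> space M - ?A k"
      using Y by (intro borel_cantelli_AE1) (auto simp: emeasure_eq_measure)
    then show ?thesis by eventually_elim (auto elim: eventually_mono)
  qed
  \<comment> \<open>The exceptional null set depends on \<open>e\<close>; a sequence of thresholds
    tending to 0 gives one null set for all of them.\<close>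
  have "AE \<omega> in M. \<forall>n. \<forall>\<^sub>F k in sequentially. Y k \<omega> < inverse (real (Suc n)) * \<Delta> k \<omega>"
    unfolding AE_all_countable using * by auto
  then show ?thesis using AE_space
  proof eventually_elim
    case (elim \<omega>)
    show ?case
    proof (intro allI impI)
      fix e :: real assume "e > 0"
      then obtain n where n: "inverse (real (Suc n)) < e" using reals_Archimedean by blast
      have "inverse (real (Suc n)) * \<Delta> k \<omega> \<le> e * \<Delta> k \<omega>" for k
        using n Delta_pos[OF elim(2), of k] by (intro mult_right_mono) auto
      then show "\<forall>\<^sub>F k in sequentially. Y k \<omega> < e * \<Delta> k \<omega>"
        using elim(1) by (auto elim!: allE[of _ n] eventually_mono intro: less_le_trans)
    qed
  qed
qed

lemma AE_errors_small:
  "AE \<omega> in M. \<forall>e>0. \<forall>\<^sub>F k in sequentially. \<bar>fc k \<omega> - f (X k \<omega>)\<bar> < e * \<Delta> k \<omega>"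
  "m \<in> {1..mbar} \<Longrightarrow> AE \<omega> in M. \<forall>e>0. \<forall>\<^sub>F k in sequentially.
     \<bar>fe k m 0 \<omega> - f (dse_trial \<gamma> X \<Delta> D k m 0 \<omega>)\<bar> < e * \<Delta> k \<omega>"
  using tail_fc tail_fe by (intro AE_error_small; simp)+

end

subsection \<open>Limit points along a path\<close>

context dse
begin

text \<open>Since \<open>p > 1\<close>, the acceptance threshold is of smaller order than the step
  size.\<close>

lemma eventually_threshold_small:
  assumes \<omega>: "\<omega> \<in> space M" and lim: "(\<lambda>k. \<Delta> k \<omega>) \<longlonglongrightarrow> 0" and c: "c > 0"
  shows "\<forall>\<^sub>F k in sequentially. \<theta> * \<Delta> k \<omega> powr p < c * \<Delta> k \<omega>"
proof -
  have "(\<lambda>k. \<theta> * \<Delta> k \<omega> powr (p - 1)) \<longlonglongrightarrow> \<theta> * 0 powr (p - 1)"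
    using lim p Delta_pos[OF \<omega>] by (intro tendsto_intros tendsto_powr') (auto simp: less_imp_le)
  then have "\<forall>\<^sub>F k in sequentially. \<theta> * \<Delta> k \<omega> powr (p - 1) < c"
    using c by (intro order_tendstoD) auto
  then show ?thesis
  proof eventually_elim
    case (elim k)
    have "\<Delta> k \<omega> powr p = \<Delta> k \<omega> powr (p - 1) * \<Delta> k \<omega>"
      using Delta_pos[OF \<omega>, of k] powr_add[of "\<Delta> k \<omega>" "p - 1" 1] by simp
    then show ?case using elim Delta_pos[OF \<omega>, of k] by simp
  qed
qed

text \<open>The true decrease \<open>c * \<Delta> k \<omega>\<close> is spent in thirds: on the two
  estimation errors and on the acceptance threshold.\<close>

lemma eventually_descent_succeeds:
  assumes \<omega>: "\<omega> \<in> space M" and lim: "(\<lambda>k. \<Delta> k \<omega>) \<longlonglongrightarrow> 0" and c: "c > 0"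
    and err_fc: "\<forall>e>0. \<forall>\<^sub>F k in sequentially. \<bar>fc k \<omega> - f (X k \<omega>)\<bar> < e * \<Delta> k \<omega>"
    and err_fe: "\<forall>e>0. \<forall>\<^sub>F k in sequentially.
      \<bar>fe k m 0 \<omega> - f (X k \<omega> + \<Delta> k \<omega> *\<^sub>R D k m \<omega>)\<bar> < e * \<Delta> k \<omega>"
  shows "\<forall>\<^sub>F k in sequentially. f (X k \<omega> + \<Delta> k \<omega> *\<^sub>R D k m \<omega>) - f (X k \<omega>) \<le> - c * \<Delta> k \<omega> \<longrightarrow>
      dse_decrease p \<theta> \<gamma> \<Delta> fc fe k m 0 \<omega>"
proof -
  have "c / 3 > 0" using c by simp
  then have "\<forall>\<^sub>F k in sequentially. \<bar>fc k \<omega> - f (X k \<omega>)\<bar> < c / 3 * \<Delta> k \<omega>"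
    "\<forall>\<^sub>F k in sequentially. \<bar>fe k m 0 \<omega> - f (X k \<omega> + \<Delta> k \<omega> *\<^sub>R D k m \<omega>)\<bar> < c / 3 * \<Delta> k \<omega>"
    "\<forall>\<^sub>F k in sequentially. \<theta> * \<Delta> k \<omega> powr p < c / 3 * \<Delta> k \<omega>"
    using err_fc err_fe eventually_threshold_small[OF \<omega> lim] by blast+
  then show ?thesis
  proof eventually_elim
    case (elim k)
    then show ?case
      unfolding dse_decrease_def dse_step_def power_0 div_by_1 abs_less_iff
      by (auto simp: field_simps)
  qed
qed

text \<open>The Lipschitz property near \<open>x\<close> transfers descent along \<open>u\<close> to
  a nearby sampled direction while keeping half of the rate.\<close>

lemma clarke_stationary_of_dense_directions:
  assumes dim: "DIM('a) \<ge> 2" and \<omega>: "\<omega> \<in> space M" and lim: "(\<lambda>k. \<Delta> k \<omega>) \<longlonglongrightarrow> 0"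
    and err_fc: "\<forall>e>0. \<forall>\<^sub>F k in sequentially. \<bar>fc k \<omega> - f (X k \<omega>)\<bar> < e * \<Delta> k \<omega>"
    and err_fe: "\<forall>e>0. \<forall>\<^sub>F k in sequentially.
      \<bar>fe k mbar 0 \<omega> - f (X k \<omega> + \<Delta> k \<omega> *\<^sub>R D k mbar \<omega>)\<bar> < e * \<Delta> k \<omega>"
    and V: "\<And>k. k \<in> V \<Longrightarrow> H k \<omega> = -1"
    and dense: "sphere 0 1 \<subseteq> closure ((\<lambda>k. Dsel k \<omega>) ` V)"
    and conv: "((\<lambda>k. X k \<omega>) \<longlongrightarrow> x) (inf sequentially (principal V))"
  shows "clarke_stationary f x"
proof (rule ccontr)
  assume "\<not> clarke_stationary f x"
  then obtain u c r where u: "norm u = 1" and c: "c > 0" and r: "r > 0"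
    and desc: "\<And>y t. y \<in> ball x r \<Longrightarrow> 0 < t \<Longrightarrow> t < r \<Longrightarrow> f (y + t *\<^sub>R u) - f y \<le> - c * t"
    by (rule not_clarke_stationaryD) blast
  obtain s L where s: "s > 0" and L: "L-lipschitz_on (ball x s) f"
    using locally_lipschitz[of x] by (auto simp: lipschitz_near_def)
  have L0: "L \<ge> 0" using L by (rule lipschitz_on_nonneg)
  \<comment> \<open>The iterate, the point reached along \<open>u\<close> and the actual trial point
    lie within one, two and three times \<rho> of \<open>x\<close>, hence in the Lipschitz
    ball.\<close>
  define \<rho> where "\<rho> = min r (s / 3)"
  have \<rho>: "\<rho> > 0" "\<rho> \<le> r" "3 * \<rho> \<le> s" using r s by (auto simp: \<rho>_def)
  \<comment> \<open>Makes the Lipschitz loss at most half of the descent rate; \<open>L + 1\<close>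
    avoids dividing by zero.\<close>
  define e where "e = min 1 (c / (2 * (L + 1)))"
  have e: "e > 0" "e \<le> 1" "L * e \<le> c / 2"
  proof -
    show "e > 0" "e \<le> 1" using c L0 by (auto simp: e_def)
    have "L * e \<le> L * (c / (2 * (L + 1)))" using L0 by (intro mult_left_mono) (auto simp: e_def)
    also have "\<dots> = (L / (L + 1)) * (c / 2)" by simp
    also have "\<dots> \<le> 1 * (c / 2)" using L0 c by (intro mult_right_mono) auto
    finally show "L * e \<le> c / 2" by simp
  qed
  have "\<forall>\<^sub>F k in sequentially. k \<in> V \<longrightarrow> dist (X k \<omega>) x < \<rho>"
    using tendstoD[OF conv \<rho>(1)] by (simp add: eventually_inf_principal)
  moreover have "\<forall>\<^sub>F k in sequentially. \<Delta> k \<omega> < \<rho>"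
    using order_tendstoD(2)[OF lim \<rho>(1)] .
  moreover have "\<forall>\<^sub>F k in sequentially. f (X k \<omega> + \<Delta> k \<omega> *\<^sub>R D k mbar \<omega>) - f (X k \<omega>) \<le> - (c / 2) * \<Delta> k \<omega> \<longrightarrow>
      dse_decrease p \<theta> \<gamma> \<Delta> fc fe k mbar 0 \<omega>"
    using c by (intro eventually_descent_succeeds[OF \<omega> lim _ err_fc err_fe]) auto
  ultimately have "\<forall>\<^sub>F k in sequentially. (k \<in> V \<longrightarrow> dist (X k \<omega>) x < \<rho>) \<and> \<Delta> k \<omega> < \<rho> \<and>
      (f (X k \<omega> + \<Delta> k \<omega> *\<^sub>R D k mbar \<omega>) - f (X k \<omega>) \<le> - (c / 2) * \<Delta> k \<omega> \<longrightarrow>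
      dse_decrease p \<theta> \<gamma> \<Delta> fc fe k mbar 0 \<omega>)"
    by eventually_elim blast
  then obtain K where K: "\<And>k. k \<ge> K \<Longrightarrow> (k \<in> V \<longrightarrow> dist (X k \<omega>) x < \<rho>) \<and> \<Delta> k \<omega> < \<rho> \<and>
      (f (X k \<omega> + \<Delta> k \<omega> *\<^sub>R D k mbar \<omega>) - f (X k \<omega>) \<le> - (c / 2) * \<Delta> k \<omega> \<longrightarrow>
      dse_decrease p \<theta> \<gamma> \<Delta> fc fe k mbar 0 \<omega>)"
    unfolding eventually_sequentially by blast
  \<comment> \<open>Density might come from early indices, but \<open>u\<close> is not isolated on
    the sphere, so an index past \<open>K\<close> must approach it.\<close>
  have "u \<in> closure ((\<lambda>k. Dsel k \<omega>) ` (V \<inter> {K..}))"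
    by (rule closure_image_tail[OF dense sphere_islimpt[OF dim u]])
  then obtain k where kV: "k \<in> V" and k: "k \<ge> K" and du: "dist (Dsel k \<omega>) u < e"
    using e(1) unfolding closure_approachable by auto
  let ?d = "D k mbar \<omega>" and ?x = "X k \<omega>" and ?\<delta> = "\<Delta> k \<omega>"
  have \<delta>: "?\<delta> > 0" "?\<delta> < \<rho>" using Delta_pos[OF \<omega>] K[OF k] by auto
  have x: "dist ?x x < \<rho>" using K[OF k] kV by blast
  have du': "norm (?d - u) \<le> e" using du unsuccessfulD(1)[OF \<omega> V[OF kV]] by (simp add: dist_norm)
  have dd: "dist (?x + ?\<delta> *\<^sub>R ?d) (?x + ?\<delta> *\<^sub>R u) = ?\<delta> * norm (?d - u)"
    using \<delta> by (simp add: dist_norm scaleR_diff_right[symmetric])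
  have xu: "dist (?x + ?\<delta> *\<^sub>R u) x < 2 * \<rho>"
    using x \<delta> u norm_triangle_ineq[of "?x - x" "?\<delta> *\<^sub>R u"] by (simp add: dist_norm algebra_simps)
  have \<delta>e: "?\<delta> * norm (?d - u) \<le> ?\<delta> * e" using du' \<delta> by (intro mult_left_mono) auto
  also have "\<dots> \<le> ?\<delta> * 1" using e \<delta> by (intro mult_left_mono) auto
  finally have "?\<delta> * norm (?d - u) \<le> ?\<delta>" by simp
  then have xd: "dist (?x + ?\<delta> *\<^sub>R ?d) x < 3 * \<rho>"
    using dd xu \<delta> dist_triangle[of "?x + ?\<delta> *\<^sub>R ?d" x "?x + ?\<delta> *\<^sub>R u"] by linarith
  have "dist (f (?x + ?\<delta> *\<^sub>R ?d)) (f (?x + ?\<delta> *\<^sub>R u)) \<le> L * (?\<delta> * norm (?d - u))"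
    unfolding dd[symmetric] using xu xd \<rho>
    by (intro lipschitz_onD[OF L]) (auto simp: dist_commute)
  also have "\<dots> \<le> L * (?\<delta> * e)" using \<delta>e L0 by (rule mult_left_mono)
  also have "\<dots> = (L * e) * ?\<delta>" by simp
  also have "\<dots> \<le> (c / 2) * ?\<delta>" using e(3) \<delta> by (intro mult_right_mono) auto
  finally have "f (?x + ?\<delta> *\<^sub>R ?d) \<le> f (?x + ?\<delta> *\<^sub>R u) + (c / 2) * ?\<delta>"
    unfolding dist_real_def by linarith
  moreover have "f (?x + ?\<delta> *\<^sub>R u) - f ?x \<le> - c * ?\<delta>"
    using x \<delta> \<rho> by (intro desc) (auto simp: dist_commute)
  ultimately have "f (?x + ?\<delta> *\<^sub>R ?d) - f ?x \<le> - (c / 2) * ?\<delta>" by (simp add: field_simps)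
  then show False using K[OF k] unsuccessfulD(2)[OF \<omega> V[OF kV]] by blast
qed

text \<open>The next step size has index \<open>max 1 h\<close>, so it is never below the distance
  just moved.\<close>

lemma step_length_le:
  assumes \<omega>: "\<omega> \<in> space M" and D: "\<And>m. m \<in> {1..mbar} \<Longrightarrow> norm (D k m \<omega>) = 1"
  shows "dist (X (Suc k) \<omega>) (X k \<omega>) \<le> \<Delta> (Suc k) \<omega>"
  using \<omega>
proof (cases rule: step_cases[of \<omega> k])
  case unsuccessful
  then show ?thesis using Delta_pos[OF \<omega>, of "Suc k"] by simp
next
  case (successful m h)
  then have "dist (X (Suc k) \<omega>) (X k \<omega>) = dse_step \<gamma> (\<Delta> k \<omega>) h"
    using D[of m] dse_step_pos[OF \<omega>, of k h] by (simp add: dse_trial_def dist_norm)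
  also have "\<dots> \<le> \<Delta> (Suc k) \<omega>" using successful dse_step_mono[OF \<omega>, of h "max 1 h" k] by simp
  finally show ?thesis .
qed

text \<open>In dimension one a dense set of directions may be attained by finitely many indices, so density
  gives nothing asymptotically. Instead, near a nonstationary limit point the first direction succeeds
  whenever it equals the descent direction, so the logarithm of the step size dominates a fair walk.\<close>

lemma clarke_stationary_dim_1:
  assumes dim: "DIM('a) = 1" and \<omega>: "\<omega> \<in> space M" and lim: "(\<lambda>k. \<Delta> k \<omega>) \<longlonglongrightarrow> 0"
    and err_fc: "\<forall>e>0. \<forall>\<^sub>F k in sequentially. \<bar>fc k \<omega> - f (X k \<omega>)\<bar> < e * \<Delta> k \<omega>"
    and err_fe: "\<forall>e>0. \<forall>\<^sub>F k in sequentially.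
      \<bar>fe k 1 0 \<omega> - f (X k \<omega> + \<Delta> k \<omega> *\<^sub>R D k 1 \<omega>)\<bar> < e * \<Delta> k \<omega>"
    and fconv: "convergent (\<lambda>k. f (X k \<omega>))"
    and D: "\<And>k m. m \<in> {1..mbar} \<Longrightarrow> norm (D k m \<omega>) = 1"
    and walk: "\<And>b. norm b = 1 \<Longrightarrow>
      \<not> filterlim (\<lambda>n. \<Sum>j<n. if 0 < D j 1 \<omega> \<bullet> b then 1 else - 1 :: real) at_bot sequentially"
    and V: "infinite V"
    and conv: "((\<lambda>k. X k \<omega>) \<longlongrightarrow> x) (inf sequentially (principal V))"
  shows "clarke_stationary f x"
proof (rule ccontr)
  assume "\<not> clarke_stationary f x"
  then obtain u c r where u: "norm u = 1" and c: "c > 0" and r: "r > 0"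
    and desc: "\<And>y t. y \<in> ball x r \<Longrightarrow> 0 < t \<Longrightarrow> t < r \<Longrightarrow> f (y + t *\<^sub>R u) - f y \<le> - c * t"
    by (rule not_clarke_stationaryD) blast
  have one: "1 \<in> {1..mbar}" using mbar by simp
  have frequentlyV: "\<exists>\<^sub>F k in sequentially. k \<in> V"
    using V by (simp add: cofinite_eq_sequentially[symmetric] frequently_cofinite)
  have VI: "inf sequentially (principal V) \<noteq> bot"
    using frequentlyV by (simp add: trivial_limit_def eventually_inf_principal frequently_def)
  \<comment> \<open>The whole sequence of values converges, and continuity along the infinite set
    \<open>V\<close> identifies its limit.\<close>
  have "(\<lambda>k. f (X k \<omega>)) \<longlonglongrightarrow> f x"
  proof -
    obtain l where l: "(\<lambda>k. f (X k \<omega>)) \<longlonglongrightarrow> l" using fconv by (auto simp: convergent_def)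
    have "((\<lambda>k. f (X k \<omega>)) \<longlongrightarrow> l) (inf sequentially (principal V))"
      using l by (rule tendsto_mono[rotated]) simp
    moreover have "((\<lambda>k. f (X k \<omega>)) \<longlongrightarrow> f x) (inf sequentially (principal V))"
      using continuous_f conv by (intro isCont_tendsto_compose[of x f]) (auto simp: continuous_on_eq_continuous_at)
    ultimately show ?thesis using l tendsto_unique[OF VI] by blast
  qed
  then have fx: "\<forall>\<^sub>F k in sequentially. dist (f (X k \<omega>)) (f x) < c * (r / 2)"
    using c r by (intro tendstoD) auto
  \<comment> \<open>On the line, descent along \<open>u\<close> runs from \<open>x\<close> to
    \<open>y\<close> or from \<open>y\<close> to \<open>x\<close>. Either way the values differ at
    least linearly, so a value close to \<open>f x\<close> forces the point close to
    \<open>x\<close>.\<close>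
  have growth: "c * dist y x \<le> dist (f y) (f x)" if y: "y \<in> ball x r" for y
  proof -
    define \<tau> where "\<tau> = (y - x) \<bullet> u"
    have yx: "y = x + \<tau> *\<^sub>R u" using DIM_1_eq_scaleR[OF dim u, of "y - x"] by (simp add: \<tau>_def algebra_simps)
    have d: "dist y x = \<bar>\<tau>\<bar>" using u by (simp add: yx dist_norm)
    have \<tau>r: "\<bar>\<tau>\<bar> < r" using y d by (simp add: dist_commute)
    consider "\<tau> = 0" | "\<tau> > 0" | "\<tau> < 0" by linarith
    then show ?thesis
    proof cases
      case 2
      then show ?thesis using desc[of x \<tau>] r \<tau>r d by (simp add: yx dist_real_def)
    next
      case 3
      then show ?thesis using desc[of y "- \<tau>"] y \<tau>r d by (simp add: yx dist_real_def)
    qed (use d in auto)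
  qed
  have step: "\<forall>\<^sub>F k in sequentially. \<Delta> (Suc k) \<omega> < r / 2"
    using r by (intro order_tendstoD(2)[OF LIMSEQ_Suc[OF lim]]) simp
  have "\<forall>\<^sub>F k in sequentially. f (X k \<omega> + \<Delta> k \<omega> *\<^sub>R D k 1 \<omega>) - f (X k \<omega>) \<le> - c * \<Delta> k \<omega> \<longrightarrow>
      dse_decrease p \<theta> \<gamma> \<Delta> fc fe k 1 0 \<omega>"
    by (rule eventually_descent_succeeds[OF \<omega> lim c err_fc err_fe])
  moreover have "\<forall>\<^sub>F k in sequentially. \<Delta> k \<omega> < r"
    using order_tendstoD(2)[OF lim r] .
  ultimately have "\<forall>\<^sub>F k in sequentially. dist (f (X k \<omega>)) (f x) < c * (r / 2) \<and> \<Delta> (Suc k) \<omega> < r / 2 \<and>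
      \<Delta> k \<omega> < r \<and> (f (X k \<omega> + \<Delta> k \<omega> *\<^sub>R D k 1 \<omega>) - f (X k \<omega>) \<le> - c * \<Delta> k \<omega> \<longrightarrow>
      dse_decrease p \<theta> \<gamma> \<Delta> fc fe k 1 0 \<omega>)"
    using fx step by eventually_elim blast
  then obtain K0 where K0: "\<And>k. k \<ge> K0 \<Longrightarrow> dist (f (X k \<omega>)) (f x) < c * (r / 2) \<and> \<Delta> (Suc k) \<omega> < r / 2 \<and>
      \<Delta> k \<omega> < r \<and> (f (X k \<omega> + \<Delta> k \<omega> *\<^sub>R D k 1 \<omega>) - f (X k \<omega>) \<le> - c * \<Delta> k \<omega> \<longrightarrow>
      dse_decrease p \<theta> \<gamma> \<Delta> fc fe k 1 0 \<omega>)"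
    unfolding eventually_sequentially by blast
  have "\<forall>\<^sub>F k in sequentially. k \<in> V \<longrightarrow> dist (X k \<omega>) x < r"
    using tendstoD[OF conv r] by (simp add: eventually_inf_principal)
  then have "\<forall>\<^sub>F k in sequentially. k \<in> V \<longrightarrow> dist (X k \<omega>) x < r \<and> k \<ge> K0"
    using eventually_ge_at_top[of K0] by eventually_elim blast
  then have "\<exists>\<^sub>F k in sequentially. dist (X k \<omega>) x < r \<and> k \<ge> K0"
    using frequentlyV by (rule frequently_mp)
  then obtain K where K: "K \<ge> K0" "dist (X K \<omega>) x < r" using frequently_ex by blast
  \<comment> \<open>Trapping: closeness of values puts the iterate within \<open>r / 2\<close> of
    \<open>x\<close>, and the next move is shorter than \<open>r / 2\<close>.\<close>
  have near: "dist (X k \<omega>) x < r" if "k \<ge> K" for k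
    using that
  proof (induction k rule: dec_induct)
    case (step k)
    then have k: "k \<ge> K0" using K by simp
    have "c * dist (X k \<omega>) x < c * (r / 2)"
      using growth[of "X k \<omega>"] step.IH K0[OF k] by (simp add: dist_commute)
    then have "dist (X k \<omega>) x < r / 2" using c by simp
    moreover have "dist (X (Suc k) \<omega>) (X k \<omega>) < r / 2"
      using step_length_le[OF \<omega> D, of k] K0[OF k] by simp
    ultimately show ?case using dist_triangle[of "X (Suc k) \<omega>" x "X k \<omega>"] by simp
  qed (use K in simp)
  define \<xi> :: "nat \<Rightarrow> real" where "\<xi> j = (if 0 < D j 1 \<omega> \<bullet> u then 1 else - 1)" for j
  have ln\<gamma>: "ln \<gamma> < 0" using gamma by simp
  \<comment> \<open>If the first direction is \<open>u\<close>, the iteration succeeds and the step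
    size grows by at least \<open>1 / \<gamma>\<close>; otherwise it shrinks by at most \<gamma>. On
    the logarithmic scale this dominates \<open>- ln \<gamma>\<close> times one coin flip.\<close>
  have grow: "ln (\<Delta> k \<omega>) - ln \<gamma> * \<xi> k \<le> ln (\<Delta> (Suc k) \<omega>)" if k: "k \<ge> K" for k
  proof (cases "0 < D k 1 \<omega> \<bullet> u")
    case True
    have Du: "D k 1 \<omega> = (D k 1 \<omega> \<bullet> u) *\<^sub>R u" by (rule DIM_1_eq_scaleR[OF dim u])
    then have "norm (D k 1 \<omega>) = norm ((D k 1 \<omega> \<bullet> u) *\<^sub>R u)" by (rule arg_cong)
    then have "D k 1 \<omega> \<bullet> u = 1" using D[OF one, of k] u True by simp
    then have "D k 1 \<omega> = u" using Du by simp
    then have "f (X k \<omega> + \<Delta> k \<omega> *\<^sub>R D k 1 \<omega>) - f (X k \<omega>) \<le> - c * \<Delta> k \<omega>"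
      using desc[of "X k \<omega>" "\<Delta> k \<omega>"] near[OF k] K0[of k] K(1) k Delta_pos[OF \<omega>, of k]
      by (simp add: dist_commute)
    then have "dse_decrease p \<theta> \<gamma> \<Delta> fc fe k 1 0 \<omega>" using K0[of k] K(1) k by simp
    then have "H k \<omega> \<noteq> -1" using successful[OF \<omega> one, of k] by auto
    with \<omega> have "\<Delta> k \<omega> / \<gamma> \<le> \<Delta> (Suc k) \<omega>"
    proof (cases rule: step_cases[of \<omega> k])
      case (successful m h)
      have "\<Delta> k \<omega> / \<gamma> = dse_step \<gamma> (\<Delta> k \<omega>) 1" by (simp add: dse_step_def)
      also have "\<dots> \<le> \<Delta> (Suc k) \<omega>" using successful dse_step_mono[OF \<omega>, of 1 "max 1 h" k] by simp
      finally show ?thesis .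
    qed simp
    then have "ln (\<Delta> k \<omega> / \<gamma>) \<le> ln (\<Delta> (Suc k) \<omega>)"
      using Delta_pos[OF \<omega>] gamma by (intro ln_mono) auto
    then show ?thesis using True Delta_pos[OF \<omega>, of k] gamma by (simp add: \<xi>_def ln_div)
  next
    case False
    have "ln (\<gamma> * \<Delta> k \<omega>) \<le> ln (\<Delta> (Suc k) \<omega>)"
      using Delta_Suc_ge[OF \<omega>, of k] Delta_pos[OF \<omega>] gamma by (intro ln_mono) auto
    then show ?thesis using False Delta_pos[OF \<omega>, of k] gamma by (simp add: \<xi>_def ln_mult)
  qed
  have dom: "ln (\<Delta> K \<omega>) - ln \<gamma> * ((\<Sum>j<n. \<xi> j) - (\<Sum>j<K. \<xi> j)) \<le> ln (\<Delta> n \<omega>)" if "n \<ge> K" for n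
    using that
  proof (induction n rule: dec_induct)
    case (step n)
    then show ?case using grow[of n] by (simp add: algebra_simps)
  qed simp
  have "filterlim (\<lambda>k. \<Delta> k \<omega>) (at_right 0) sequentially"
    using lim Delta_pos[OF \<omega>] by (intro tendsto_imp_filterlim_at_right) auto
  then have lnlim: "filterlim (\<lambda>k. ln (\<Delta> k \<omega>)) at_bot sequentially"
    by (rule filterlim_compose[OF ln_at_0])
  \<comment> \<open>By \<open>dom\<close>, logarithms tending to minus infinity drag the walk along,
    which \<open>walk\<close> forbids.\<close>
  have "filterlim (\<lambda>n. \<Sum>j<n. \<xi> j) at_bot sequentially"
    unfolding filterlim_at_bot
  proof
    fix Z
    have "\<forall>\<^sub>F n in sequentially. ln (\<Delta> n \<omega>) \<le> ln (\<Delta> K \<omega>) - ln \<gamma> * (Z - (\<Sum>j<K. \<xi> j))"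
      using lnlim unfolding filterlim_at_bot by blast
    then show "\<forall>\<^sub>F n in sequentially. (\<Sum>j<n. \<xi> j) \<le> Z"
      using eventually_ge_at_top[of K]
    proof eventually_elim
      case (elim n)
      then have "(- ln \<gamma>) * (\<Sum>j<n. \<xi> j) \<le> (- ln \<gamma>) * Z"
        using dom[of n] by (simp add: algebra_simps)
      then show ?case using ln\<gamma> by (simp add: mult_le_cancel_left_pos)
    qed
  qed
  then show False using walk[OF u] by (simp add: \<xi>_def)
qed

end

section \<open>From pathwise statements to the almost sure conclusion\<close>

context dse_tame
begin

text \<open>All exceptional null sets are fixed before \<open>V\<close> and \<open>x\<close> are
  chosen, so the pathwise lemmas apply to every index set at once.\<close>

theorem AE_clarke_stationary:
  "AE \<omega> in M. \<forall>V x. V \<subseteq> {k. H k \<omega> = -1} \<and> infinite V \<and>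
     sphere 0 1 \<subseteq> closure ((\<lambda>k. Dsel k \<omega>) ` V) \<and>
     ((\<lambda>k. X k \<omega>) \<longlongrightarrow> x) (inf sequentially (principal V)) \<longrightarrow> clarke_stationary f x"
proof (cases "DIM('b) = 1")
  case True
  then obtain b :: 'b where b: "Basis = {b}" using card_1_singletonE by metis
  then have nb: "norm b = 1" by (metis norm_Basis singletonI)
  then have nb': "norm (- b) = 1" by simp
  have one: "1 \<in> {1..mbar}" using mbar by simp
  have "AE \<omega> in M. \<forall>k. \<forall>m\<in>{1..mbar}. norm (D k m \<omega>) = 1"
    by (simp add: AE_all_countable AE_ball_countable AE_norm_D)
  moreover note AE_direction_walk_not_at_bot[OF True nb] AE_direction_walk_not_at_bot[OF True nb']
  ultimately show ?thesis
    using AE_space AE_Delta_tendsto_0 AE_errors_small(1) AE_errors_small(2)[OF one] AE_convergent_f_X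
  proof eventually_elim
    case (elim \<omega>)
    \<comment> \<open>The walk property holds almost surely for each fixed vector; with only two
      unit vectors on the line, it holds for all simultaneously.\<close>
    have pm: "a = b \<or> a = - b" if "norm a = 1" for a
    proof -
      have a: "a = (a \<bullet> b) *\<^sub>R b" by (rule DIM_1_eq_scaleR[OF True nb])
      then have "norm a = norm ((a \<bullet> b) *\<^sub>R b)" by (rule arg_cong)
      then have "\<bar>a \<bullet> b\<bar> = 1" using that nb by simp
      then show ?thesis using a by (auto simp: abs_if split: if_splits)
    qed
    have walk: "\<not> filterlim (\<lambda>n. \<Sum>j<n. if 0 < D j 1 \<omega> \<bullet> a then 1 else - 1 :: real) at_bot sequentially"
      if "norm a = 1" for a
      by (rule disjE[OF pm[OF that]]) (simp_all only: elim not_False_eq_True)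
    show ?case
    proof (intro allI impI, elim conjE)
      fix V x assume V: "infinite V"
        and conv: "((\<lambda>k. X k \<omega>) \<longlongrightarrow> x) (inf sequentially (principal V))"
      show "clarke_stationary f x"
        by (rule clarke_stationary_dim_1[OF True _ _ _ _ _ _ walk V conv])
          (use elim in \<open>auto simp: dse_trial_def dse_step_def\<close>)
    qed
  qed
next
  case False
  then have dim: "DIM('b) \<ge> 2" using DIM_positive[where 'a = 'b] by linarith
  have last: "mbar \<in> {1..mbar}" using mbar by simp
  show ?thesis
    using AE_space AE_Delta_tendsto_0 AE_errors_small(1) AE_errors_small(2)[OF last]
  proof eventually_elim
    case (elim \<omega>)
    show ?case
    proof (intro allI impI, elim conjE)
      fix V x assume V: "V \<subseteq> {k. H k \<omega> = - 1}" and dense: "sphere 0 1 \<subseteq> closure ((\<lambda>k. Dsel k \<omega>) ` V)"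
        and conv: "((\<lambda>k. X k \<omega>) \<longlongrightarrow> x) (inf sequentially (principal V))"
      show "clarke_stationary f x"
        using elim V
        by (intro clarke_stationary_of_dense_directions[OF dim _ _ _ _ _ dense conv])
          (auto simp: dse_trial_def dse_step_def)
    qed
  qed
qed

end

theorem theorem4p1:
  fixes M :: "'w measure"
    and p \<theta> \<gamma> \<eta> c_max \<delta>0 :: real
    and mbar ibar :: nat
    and f :: "real ^ 'n \<Rightarrow> real"
    and x0 :: "real ^ 'n"
    and G F :: "nat \<Rightarrow> 'w measure"
    and X :: "nat \<Rightarrow> 'w \<Rightarrow> real ^ 'n"
    and \<Delta> :: "nat \<Rightarrow> 'w \<Rightarrow> real"
    and D :: "nat \<Rightarrow> nat \<Rightarrow> 'w \<Rightarrow> real ^ 'n"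
    and fc :: "nat \<Rightarrow> 'w \<Rightarrow> real"
    and fe :: "nat \<Rightarrow> nat \<Rightarrow> nat \<Rightarrow> 'w \<Rightarrow> real"
    and H :: "nat \<Rightarrow> 'w \<Rightarrow> int"
    and Dsel :: "nat \<Rightarrow> 'w \<Rightarrow> real ^ 'n"
    and U :: "'w \<Rightarrow> nat set"
  defines "F \<equiv> dse_dir_algebra M mbar G D"
    and "U \<equiv> (\<lambda>\<omega>. {k. H k \<omega> = -1})"
  assumes algorithm: "dse M p \<theta> \<gamma> mbar ibar f x0 \<delta>0 G X \<Delta> D fc fe H Dsel"
    and lipschitz_limit_points:
      "AE \<omega> in M. \<forall>x r. strict_mono r \<and> (\<lambda>j. X (r j) \<omega>) \<longlonglongrightarrow> x \<longrightarrow> lipschitz_near f x"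
    and compactness: "\<exists>C. C \<noteq> {} \<and> compact C \<and> (\<forall>k. AE \<omega> in M. X k \<omega> \<in> C)"
    and independence:
      "\<forall>k. cond_indep_vars M (F k) (\<lambda>_. borel) (case_option (fc k) (\<lambda>(m, i). fe k m i))
             (insert None (Some ` ({1..mbar} \<times> {0..ibar})))"
    and tail:
      "\<exists>\<epsilon>>0. \<forall>k. \<forall>\<alpha>\<ge>\<epsilon>. \<forall>i\<in>{0..ibar}. \<forall>m\<in>{1..mbar}.
         (AE \<omega> in M. cprob M (F k)
            {\<omega> \<in> space M. \<bar>fc k \<omega> - f (X k \<omega>)\<bar> \<ge> \<alpha> * \<Delta> k \<omega> powr p} \<omega>
              \<le> \<epsilon> / \<alpha> powr (p / (p - 1))) \<and>
         (AE \<omega> in M. cprob M (F k)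
            {\<omega> \<in> space M. \<bar>fe k m i \<omega> - f (dse_trial \<gamma> X \<Delta> D k m i \<omega>)\<bar> \<ge> \<alpha> * \<Delta> k \<omega> powr p} \<omega>
              \<le> \<epsilon> / \<alpha> powr (p / (p - 1)))"
    and c_max_pos: "c_max > 0"
    and c_max:
      "\<forall>k. AE \<omega> in M.
         nn_cond_exp M (F k) (\<lambda>\<omega>. ennreal (dse_Emax \<gamma> mbar ibar f X \<Delta> D fc fe k \<omega>)) \<omega>
           \<le> ennreal (c_max * \<Delta> k \<omega> powr p)"
    and eta: "\<eta> > 0" "\<eta> > c_max / (1 - \<gamma> powr p)"
    and theta_eta: "\<theta> \<ge> \<eta> * max 1 (\<gamma> powr (- p) - \<gamma> powr p)"
  shows "AE \<omega> in M. \<forall>V xs. V \<subseteq> U \<omega> \<and> infinite V \<and>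
           sphere 0 1 \<subseteq> closure ((\<lambda>k. Dsel k \<omega>) ` V) \<and>
           ((\<lambda>k. X k \<omega>) \<longlongrightarrow> xs) (inf sequentially (principal V)) \<longrightarrow>
           clarke_stationary f xs"
proof -
  interpret dse M p \<theta> \<gamma> mbar ibar f x0 \<delta>0 G X \<Delta> D fc fe H Dsel by (rule algorithm)
  obtain C where C: "compact C" "\<forall>k. AE \<omega> in M. X k \<omega> \<in> C" using compactness by blast
  obtain \<epsilon> where \<epsilon>: "\<epsilon> > 0" and tails: "\<forall>k. \<forall>\<alpha>\<ge>\<epsilon>. \<forall>i\<in>{0..ibar}. \<forall>m\<in>{1..mbar}.
         (AE \<omega> in M. cprob M (F k)
            {\<omega> \<in> space M. \<bar>fc k \<omega> - f (X k \<omega>)\<bar> \<ge> \<alpha> * \<Delta> k \<omega> powr p} \<omega>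
              \<le> \<epsilon> / \<alpha> powr (p / (p - 1))) \<and>
         (AE \<omega> in M. cprob M (F k)
            {\<omega> \<in> space M. \<bar>fe k m i \<omega> - f (dse_trial \<gamma> X \<Delta> D k m i \<omega>)\<bar> \<ge> \<alpha> * \<Delta> k \<omega> powr p} \<omega>
              \<le> \<epsilon> / \<alpha> powr (p / (p - 1)))"
    using tail by blast
  \<comment> \<open>The bound on \<open>fc\<close> stands under the quantifiers over
    \<open>i\<close> and \<open>m\<close>, so extracting it takes nonempty index ranges.\<close>
  have "1 \<in> {1..mbar}" "0 \<in> {0..ibar}" using mbar by auto
  then interpret dse_tame M p \<theta> \<gamma> mbar ibar f x0 \<delta>0 G X \<Delta> D fc fe H Dsel \<eta> c_max \<epsilon> C
    using C \<epsilon> tails c_max c_max_pos eta theta_eta unfolding F_def by unfold_locales blast+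
  show ?thesis unfolding U_def by (rule AE_clarke_stationary)
qed

end
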